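(* Let $\mathcal{K}\subset\widehat{\mathbb{C}}=\mathbb{C}\cup\{\infty\}$ be a domain with $\infty\in\mathcal{K}$ whose boundary $\Gamma$ consists of $\ell$ pairwise disjoint closed Jordan curves $\Gamma_1,\ldots,\Gamma_\ell$ with the smooth parametrization $\eta$ on $J$ described in the context. Let $\Phi:\mathcal{K}\to\mathcal{L}$ be the conformal map onto the lemniscatic domain with centers $a_1,\ldots,a_\ell$ given by Walsh's theorem, extended continuously to $\Gamma$, and fix a point $\alpha_j$ in the interior of $\Gamma_j$ for each $j=1,\ldots,\ell$. Then the boundary values of $\Phi$ and the constants $a_1,\ldots,a_\ell$ satisfy the $\ell$ equations $$\frac{1}{2\pi\mathrm{i}}\int_J\log\left(\frac{\Phi(\eta(t))-a_j}{\eta(t)-\alpha_j}\right)\dot\eta(t)\,dt+\alpha_j-a_j=0,\qquad j=1,2,\ldots,\ell.$$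
   Context: Boundary parametrization. $\Gamma$ is oriented so that $\mathcal{K}$ lies to the left of $\Gamma$. Each $\Gamma_j$ is parametrized (consistently with this orientation) by a $2\pi$-periodic, twice continuously differentiable complex function $\eta_j(t)$, $t\in J_j=[0,2\pi]$, with $\dot\eta_j(t)\neq0$. $J$ is the disjoint union of $J_1,\ldots,J_\ell$, and $\eta$ on $J$ is defined by $\eta(t)=\eta_j(t)$ for $t\in J_j$; an integral over $J$ is the sum of the integrals over $J_1,\ldots,J_\ell$. A dot denotes the derivative with respect to $t$. Walsh's theorem (known). For $\mathcal{K}$ as in the claim there exist a unique lemniscatic domain $$\mathcal{L}=\Big\{w\in\widehat{\mathbb{C}}:\prod_{j=1}^\ell|w-a_j|^{m_j}>\tau\Big\},$$ with $a_1,\ldots,a_\ell\in\mathbb{C}$ pairwise distinct, $m_1,\ldots,m_\ell,\tau>0$ real and $\sum_{j=1}^\ell m_j=1$, and a unique bijective conformal map $\Phi:\mathcal{K}\to\mathcal{L}$ with $\Phi(z)=z+O(1/z)$ near infinity. $\Phi$ extends to a continuous bijection $\overline{\mathcal{K}}\to\overline{\mathcal{L}}$, and for each $j$ the image $\Phi(\Gamma_j)$ contains $a_j$ in its interior. Logarithm. The branch of the logarithm with $\log(1)=0$ is used: for each $j$, $\log\frac{\Phi(z)-a_j}{z-\alpha_j}$ denotes the single-valued analytic branch in $\mathcal{K}$ (including $\infty$) that vanishes at $\infty$, and its values on $\Gamma$ are those of its continuous extension. *)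

theory Defs
  imports "HOL-Complex_Analysis.Complex_Analysis"
begin

text \<open>
  A domain of the Riemann sphere containing \<open>\<infinity>\<close> is represented by its finite part, an open
  connected set \<open>K \<subseteq> \<complex>\<close> with bounded complement. Removing the point \<open>\<infinity>\<close> from a domain of the
  sphere does not affect its connectedness, and the boundary lies in \<open>\<complex>\<close>.
\<close>

definition domain_at_infinity :: "complex set \<Rightarrow> bool" where
  "domain_at_infinity K \<longleftrightarrow> open K \<and> connected K \<and> bounded (- K)"

definition smooth_jordan_param :: "(real \<Rightarrow> complex) \<Rightarrow> bool" where
  "smooth_jordan_param \<eta> \<longleftrightarrow>
     (\<forall>t. \<eta> (t + 2 * pi) = \<eta> t) \<and>
     (\<forall>t. \<eta> differentiable at t) \<and>
     (\<lambda>t. vector_derivative \<eta> (at t)) C1_differentiable_on UNIV \<and>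
     (\<forall>t. vector_derivative \<eta> (at t) \<noteq> 0) \<and>
     inj_on \<eta> {0..<2 * pi}"

text \<open>\<open>K\<close> lies to the left of \<open>\<eta>\<close>: the left normal \<open>\<i> \<eta>'(t)\<close> points into \<open>K\<close> at every point.\<close>

definition lies_left_of :: "complex set \<Rightarrow> (real \<Rightarrow> complex) \<Rightarrow> bool" where
  "lies_left_of K \<eta> \<longleftrightarrow>
     (\<forall>t. \<forall>\<^sub>F \<epsilon> in at_right 0. \<eta> t + of_real \<epsilon> * (\<i> * vector_derivative \<eta> (at t)) \<in> K)"

definition curve_trace :: "(real \<Rightarrow> complex) \<Rightarrow> complex set" where
  "curve_trace \<eta> = \<eta> ` {0..2 * pi}"

definition boundary_param :: "complex set \<Rightarrow> nat \<Rightarrow> (nat \<Rightarrow> real \<Rightarrow> complex) \<Rightarrow> bool" where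
  "boundary_param K l \<eta> \<longleftrightarrow>
     (\<forall>j\<in>{1..l}. smooth_jordan_param (\<eta> j) \<and> lies_left_of K (\<eta> j)) \<and>
     (\<forall>j\<in>{1..l}. \<forall>k\<in>{1..l}. j \<noteq> k \<longrightarrow> curve_trace (\<eta> j) \<inter> curve_trace (\<eta> k) = {}) \<and>
     frontier K = (\<Union>j\<in>{1..l}. curve_trace (\<eta> j))"

text \<open>The finite part of the lemniscatic domain; the point \<open>\<infinity>\<close> always belongs to it.\<close>

definition lemniscatic_domain ::
    "nat \<Rightarrow> (nat \<Rightarrow> complex) \<Rightarrow> (nat \<Rightarrow> real) \<Rightarrow> real \<Rightarrow> complex set" where
  "lemniscatic_domain l a m \<tau> = {w. (\<Prod>j=1..l. cmod (w - a j) powr m j) > \<tau>}"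

definition lemniscatic_data ::
    "nat \<Rightarrow> (nat \<Rightarrow> complex) \<Rightarrow> (nat \<Rightarrow> real) \<Rightarrow> real \<Rightarrow> bool" where
  "lemniscatic_data l a m \<tau> \<longleftrightarrow>
     inj_on a {1..l} \<and> (\<forall>j\<in>{1..l}. m j > 0) \<and> \<tau> > 0 \<and> (\<Sum>j=1..l. m j) = 1"

text \<open>
  The map of Walsh's theorem, already extended to the closure. The normalization forces
  \<open>\<Phi>(\<infinity>) = \<infinity>\<close> with a simple pole there, so conformality on the sphere reduces to
  conformality on the finite parts. The last conjunct fixes the labelling of the centers by
  the boundary curves.
\<close>

definition walsh_map ::
    "complex set \<Rightarrow> nat \<Rightarrow> (nat \<Rightarrow> real \<Rightarrow> complex) \<Rightarrow>
     (nat \<Rightarrow> complex) \<Rightarrow> (nat \<Rightarrow> real) \<Rightarrow> real \<Rightarrow> (complex \<Rightarrow> complex) \<Rightarrow> bool" where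
  "walsh_map K l \<eta> a m \<tau> \<Phi> \<longleftrightarrow>
     lemniscatic_data l a m \<tau> \<and>
     \<Phi> holomorphic_on K \<and>
     bij_betw \<Phi> K (lemniscatic_domain l a m \<tau>) \<and>
     (\<lambda>z. \<Phi> z - z) \<in> O[at_infinity](\<lambda>z. 1 / z) \<and>
     continuous_on (closure K) \<Phi> \<and>
     bij_betw \<Phi> (closure K) (closure (lemniscatic_domain l a m \<tau>)) \<and>
     (\<forall>j\<in>{1..l}. a j \<in> inside (\<Phi> ` curve_trace (\<eta> j)))"

text \<open>
  \<open>g\<close> is the branch of \<open>log f\<close> on \<open>K \<union> {\<infinity>}\<close> that vanishes at \<open>\<infinity>\<close>, together with its continuous
  extension to the boundary. Analyticity of \<open>g\<close> at \<open>\<infinity>\<close> follows from the limit, by removability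
  of the singularity. Such a \<open>g\<close> is unique on the closure of \<open>K\<close>, as shown below.
\<close>

definition log_branch :: "complex set \<Rightarrow> (complex \<Rightarrow> complex) \<Rightarrow> (complex \<Rightarrow> complex) \<Rightarrow> bool" where
  "log_branch K f g \<longleftrightarrow>
     g holomorphic_on K \<and> (\<forall>z\<in>K. exp (g z) = f z) \<and> (g \<longlongrightarrow> 0) at_infinity \<and>
     continuous_on (closure K) g"

lemma log_branch_unique:
  assumes K: "domain_at_infinity K" and g: "log_branch K f g" and h: "log_branch K f h"
    and z: "z \<in> closure K"
  shows "g z = h z"
proof -
  define d where "d = (\<lambda>z. g z - h z)"
  have op: "connected K" and bd: "bounded (- K)"
    using K by (auto simp: domain_at_infinity_def)
  have cl: "continuous_on (closure K) d"
    using g h unfolding d_def log_branch_def by (intro continuous_intros) auto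
  then have cd: "continuous_on K d"
    using closure_subset continuous_on_subset by blast
  have lim: "(d \<longlongrightarrow> 0) at_infinity"
    using g h unfolding d_def log_branch_def by (auto intro: tendsto_eq_intros)
  have ex: "exp (d z) = 1" if "z \<in> K" for z
    using g h that unfolding d_def log_branch_def by (metis divide_self exp_diff exp_not_eq_zero)
  have sep: "1 \<le> norm (d y - d x)" if xy: "x \<in> K" "y \<in> K" "d y \<noteq> d x" for x y
  proof -
    have "exp (d y) = exp (d x)" using ex xy by simp
    then obtain n :: int where n: "d y = d x + of_int (2 * n) * of_real pi * \<i>"
      unfolding exp_eq by auto
    then have "n \<noteq> 0" using xy by auto
    then have "1 \<le> \<bar>real_of_int n\<bar>" by linarith
    then have "1 * 1 \<le> (2 * \<bar>real_of_int n\<bar>) * pi"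
      using pi_ge_two by (intro mult_mono) auto
    then show ?thesis by (simp add: n norm_mult)
  qed
  have "d constant_on K"
    by (rule continuous_discrete_range_constant[OF op cd]) (use sep in \<open>force intro: exI[of _ 1]\<close>)
  then obtain c where c: "\<And>x. x \<in> K \<Longrightarrow> d x = c"
    by (auto simp: constant_on_def)
  obtain B where B: "\<And>x. x \<in> - K \<Longrightarrow> norm x \<le> B"
    using bd by (auto simp: bounded_iff)
  have "\<forall>\<^sub>F x in at_infinity. x \<in> K"
    unfolding eventually_at_infinity
    by (intro exI[of _ "B + 1"]) (use B in fastforce)
  then have "\<forall>\<^sub>F x in at_infinity. d x = c"
    by eventually_elim (rule c)
  with lim have "((\<lambda>_. c) \<longlongrightarrow> 0) (at_infinity :: complex filter)"
    using tendsto_cong by force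
  then have "c = 0"
    using tendsto_unique[OF trivial_limit_at_infinity] tendsto_const by blast
  then have "d z = 0"
    using continuous_constant_on_closure[OF cl] c z by blast
  then show ?thesis by (simp add: d_def)
qed

end

theory Submission imports Defs begin

text \<open>
  The branch \<open>g\<close> of \<open>log ((\<Phi>(z) - a\<^sub>j) / (z - \<alpha>\<^sub>j))\<close> vanishes at \<open>\<infinity>\<close> and satisfies
  \<open>z g(z) \<rightarrow> \<alpha>\<^sub>j - a\<^sub>j\<close>, so its integral over large circles is \<open>2 \<pi> \<i> (\<alpha>\<^sub>j - a\<^sub>j)\<close>. By Cauchy's
  theorem on the part of \<open>K\<close> inside such a circle, the integral of \<open>g\<close> over the boundary curves is the
  negative of this number. Cauchy's theorem needs the winding numbers of the boundary about points
  outside \<open>K\<close>: Janiszewski's theorem shows that the complement of \<open>K\<close> is the union of the closed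
  Jordan interiors, these are pairwise disjoint, and since \<open>K\<close> lies to the left, the jump
  of the winding number across a curve forces the value \<open>-1\<close> inside it.
\<close>

text \<open>Two obstacles shape the argument. The branch \<open>g\<close> is only continuous up to
  the boundary, and a point outside \<open>K\<close> may lie on a boundary curve, where the winding
  number of that curve has no meaning. Both disappear for curves pushed into \<open>K\<close>; two
  derivatives of the parametrization make the pushed curves C1. The left condition, however, is
  pointwise: the admissible shift length may depend on the parameter. A uniform length comes from a
  one-sided tubular neighbourhood: a thin strip of shifted points misses the whole boundary, is
  connected and meets \<open>K\<close>, hence lies in \<open>K\<close>. The limit of z g(z) arises
  because \<open>\<Phi> z - z\<close> tends to 0: the quotient is 1 + (\<alpha> - a)/z + o(1/z), its
  small logarithm has the same leading term, and only the coefficient of 1/z survives on large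
  circles.\<close>

section \<open>Cauchy's theorem for cycles\<close>

text \<open>Conjugating every loop by a path to a common base point turns a cycle into a single closed
  path, which reduces Cauchy's theorem for cycles to the one for closed paths.\<close>

lemma closed_path_of_cycle:
  fixes \<gamma> :: "'i \<Rightarrow> real \<Rightarrow> complex"
  assumes S: "open S" "connected S" "p \<in> S" and "finite I"
    and \<gamma>: "\<And>i. i \<in> I \<Longrightarrow> valid_path (\<gamma> i) \<and> pathfinish (\<gamma> i) = pathstart (\<gamma> i) \<and> path_image (\<gamma> i) \<subseteq> S"
  shows "\<exists>\<Gamma>. valid_path \<Gamma> \<and> pathstart \<Gamma> = p \<and> pathfinish \<Gamma> = p \<and> path_image \<Gamma> \<subseteq> S \<and>
           (\<forall>z. z \<notin> S \<longrightarrow> winding_number \<Gamma> z = (\<Sum>i\<in>I. winding_number (\<gamma> i) z)) \<and>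
           (\<forall>f. f holomorphic_on S \<longrightarrow> contour_integral \<Gamma> f = (\<Sum>i\<in>I. contour_integral (\<gamma> i) f))"
  using \<open>finite I\<close> \<gamma>
proof (induction I)
  case empty
  have "valid_path (linepath p p)" "path_image (linepath p p) \<subseteq> S"
    using S by auto
  moreover have "winding_number (linepath p p) z = 0" if "z \<notin> S" for z
    using that S by (intro winding_number_trivial) auto
  moreover have "pathstart (linepath p p) = p" "pathfinish (linepath p p) = p"
    "contour_integral (linepath p p) f = 0" for f
    by (simp_all only: pathstart_linepath pathfinish_linepath contour_integral_trivial)
  ultimately show ?case
    unfolding sum.empty by blast
next
  case (insert i I)
  then obtain \<Gamma> where \<Gamma>: "valid_path \<Gamma>" "pathstart \<Gamma> = p" "pathfinish \<Gamma> = p" "path_image \<Gamma> \<subseteq> S"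
    and w: "\<And>z. z \<notin> S \<Longrightarrow> winding_number \<Gamma> z = (\<Sum>i\<in>I. winding_number (\<gamma> i) z)"
    and c: "\<And>f. f holomorphic_on S \<Longrightarrow> contour_integral \<Gamma> f = (\<Sum>i\<in>I. contour_integral (\<gamma> i) f)"
    by blast
  have gi: "valid_path (\<gamma> i)" "pathfinish (\<gamma> i) = pathstart (\<gamma> i)" "path_image (\<gamma> i) \<subseteq> S"
    using insert.prems by auto
  then have "pathstart (\<gamma> i) \<in> S"
    using pathstart_in_path_image by blast
  then obtain q where "polynomial_function q" and q: "path_image q \<subseteq> S" "pathstart q = p"
      "pathfinish q = pathstart (\<gamma> i)"
    using connected_open_polynomial_connected[OF S] by blast
  then have vq: "valid_path q" by (simp add: valid_path_polynomial_function)
  let ?\<Delta> = "\<Gamma> +++ (q +++ (\<gamma> i +++ reversepath q))"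
  have "valid_path ?\<Delta>" "pathstart ?\<Delta> = p" "pathfinish ?\<Delta> = p" "path_image ?\<Delta> \<subseteq> S"
    using \<Gamma> gi q vq by (auto simp: path_image_join intro!: valid_path_join)
  moreover have "winding_number ?\<Delta> z = (\<Sum>i\<in>insert i I. winding_number (\<gamma> i) z)" if "z \<notin> S" for z
  proof -
    have "z \<notin> path_image \<Gamma>" "z \<notin> path_image q" "z \<notin> path_image (\<gamma> i)"
      using that \<Gamma> gi q by auto
    then have "winding_number ?\<Delta> z = winding_number \<Gamma> z + winding_number (\<gamma> i) z"
      using \<Gamma> gi q vq
      by (simp add: winding_number_join winding_number_reversepath valid_path_imp_path
            path_image_join)
    then show ?thesis using insert.hyps w[OF that] by simp
  qed
  moreover have "contour_integral ?\<Delta> f = (\<Sum>i\<in>insert i I. contour_integral (\<gamma> i) f)"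
    if f: "f holomorphic_on S" for f
  proof -
    have int: "f contour_integrable_on \<Gamma>" "f contour_integrable_on q" "f contour_integrable_on \<gamma> i"
      using \<Gamma> gi q vq S f by (auto intro: contour_integrable_holomorphic_simple)
    then have "contour_integral ?\<Delta> f = contour_integral \<Gamma> f + contour_integral (\<gamma> i) f"
      using \<Gamma> gi q vq
      by (simp add: contour_integrable_joinI contour_integrable_reversepath
            contour_integral_reversepath valid_path_join)
    then show ?thesis using insert.hyps c[OF f] by simp
  qed
  ultimately show ?case by blast
qed

lemma Cauchy_theorem_cycle:
  fixes \<gamma> :: "'i \<Rightarrow> real \<Rightarrow> complex"
  assumes S: "open S" "connected S" and f: "f holomorphic_on S" and I: "finite I"
    and \<gamma>: "\<And>i. i \<in> I \<Longrightarrow> valid_path (\<gamma> i) \<and> pathfinish (\<gamma> i) = pathstart (\<gamma> i) \<and> path_image (\<gamma> i) \<subseteq> S"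
    and zero: "\<And>z. z \<notin> S \<Longrightarrow> (\<Sum>i\<in>I. winding_number (\<gamma> i) z) = 0"
  shows "(\<Sum>i\<in>I. contour_integral (\<gamma> i) f) = 0"
proof (cases "S = {}")
  case True
  then have "I = {}" using \<gamma> path_image_nonempty by fastforce
  then show ?thesis by simp
next
  case False
  then obtain p where "p \<in> S" by blast
  have "\<exists>\<Gamma>. valid_path \<Gamma> \<and> pathstart \<Gamma> = p \<and> pathfinish \<Gamma> = p \<and> path_image \<Gamma> \<subseteq> S \<and>
      (\<forall>z. z \<notin> S \<longrightarrow> winding_number \<Gamma> z = (\<Sum>i\<in>I. winding_number (\<gamma> i) z)) \<and>
      (\<forall>f. f holomorphic_on S \<longrightarrow> contour_integral \<Gamma> f = (\<Sum>i\<in>I. contour_integral (\<gamma> i) f))"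
    by (rule closed_path_of_cycle[OF S \<open>p \<in> S\<close> I]) (rule \<gamma>)
  then obtain \<Gamma> where \<Gamma>: "valid_path \<Gamma>" "pathstart \<Gamma> = p" "pathfinish \<Gamma> = p" "path_image \<Gamma> \<subseteq> S"
    and w: "\<And>z. z \<notin> S \<Longrightarrow> winding_number \<Gamma> z = (\<Sum>i\<in>I. winding_number (\<gamma> i) z)"
    and c: "\<And>f. f holomorphic_on S \<Longrightarrow> contour_integral \<Gamma> f = (\<Sum>i\<in>I. contour_integral (\<gamma> i) f)"
    by blast
  have "(f has_contour_integral 0) \<Gamma>"
    using \<Gamma> w zero by (intro Cauchy_theorem_global[OF S(1) f]) auto
  then show ?thesis using c[OF f] contour_integral_unique by metis
qed

section \<open>The jump of the winding number across a path\<close>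

text \<open>The factor \<open>c\<close> rotates the branch cut at \<open>z\<close> into a direction
  that the path avoids, so that \<open>Ln (c * (w - z))\<close> is a primitive of
  \<open>1 / (w - z)\<close> along the path.\<close>

lemma winding_number_Ln:
  assumes g: "valid_path g" and c: "c \<noteq> 0"
    and slit: "\<And>w. w \<in> path_image g \<Longrightarrow> c * (w - z) \<notin> \<real>\<^sub>\<le>\<^sub>0"
  shows "winding_number g z =
           (Ln (c * (pathfinish g - z)) - Ln (c * (pathstart g - z))) / (2 * of_real pi * \<i>)"
proof -
  have "((\<lambda>w. Ln (c * (w - z))) has_field_derivative 1 / (w - z)) (at w within path_image g)"
    if "w \<in> path_image g" for w
  proof -
    have "c * (w - z) \<noteq> 0" using slit[OF that] by force
    then show ?thesis
      using slit[OF that] c by (auto intro!: derivative_eq_intros simp: divide_simps)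
  qed
  then have "((\<lambda>w. 1 / (w - z)) has_contour_integral
      (Ln (c * (pathfinish g - z)) - Ln (c * (pathstart g - z)))) g"
    using contour_integral_primitive[where S = "path_image g" and g = g and f = "\<lambda>w. Ln (c * (w - z))"] g by simp
  moreover have "z \<notin> path_image g" using slit[of z] by auto
  ultimately show ?thesis
    using g by (simp add: winding_number_valid_path contour_integral_unique)
qed

text \<open>The two arguments are opposite, so their logarithms differ by a half turn, whose sign is
  that of Im(iw) = Re w. The jump of the winding number has its source here.\<close>

lemma Ln_ii_diff:
  assumes "Re w \<noteq> 0"
  shows "Ln (\<i> * w) - Ln (- \<i> * w) = (if Re w > 0 then 1 else -1) * \<i> * of_real pi"
proof -
  have "\<i> * w \<noteq> 0" using assms by auto
  then have "Ln (- (\<i> * w)) = Ln (\<i> * w) + (if Re w > 0 then -1 else 1) * \<i> * of_real pi"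
    using assms by (subst Ln_minus) (auto)
  then show ?thesis by auto
qed

text \<open>Crossing the path from right to left raises the winding number by one: near the crossing
  point the path is a graph over its tangent, and the branches of the logarithm cut along the two
  normals differ by \<open>\<plusminus>\<i>\<pi>\<close> on the two halves of the tangent.\<close>

lemma winding_number_jump:
  assumes \<gamma>: "valid_path \<gamma>" and ab: "0 \<le> a" "a < t" "t < b" "b \<le> 1" and d: "d \<noteq> 0"
    and neg: "\<And>u. a \<le> u \<Longrightarrow> u < t \<Longrightarrow> Re ((\<gamma> u - \<gamma> t) / d) < 0"
    and pos: "\<And>u. t < u \<Longrightarrow> u \<le> b \<Longrightarrow> Re ((\<gamma> u - \<gamma> t) / d) > 0"
    and off: "\<gamma> t \<notin> \<gamma> ` ({0..a} \<union> {b..1})"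
  shows "((\<lambda>\<epsilon>. winding_number \<gamma> (\<gamma> t + of_real \<epsilon> * (\<i> * d)) - winding_number \<gamma> (\<gamma> t - of_real \<epsilon> * (\<i> * d)))
            \<longlongrightarrow> 1) (at_right 0)"
proof -
  define \<gamma>1 \<gamma>2 \<gamma>3 where g_defs: "\<gamma>1 = subpath 0 a \<gamma>" "\<gamma>2 = subpath a b \<gamma>" "\<gamma>3 = subpath b 1 \<gamma>"
  have path: "path \<gamma>" using \<gamma> valid_path_imp_path by blast
  have valid: "valid_path \<gamma>1" "valid_path \<gamma>2" "valid_path \<gamma>3"
    using \<gamma> ab by (auto simp: g_defs intro!: valid_path_subpath)
  have im: "path_image \<gamma>1 = \<gamma> ` {0..a}" "path_image \<gamma>2 = \<gamma> ` {a..b}" "path_image \<gamma>3 = \<gamma> ` {b..1}"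
    using ab by (auto simp: g_defs path_image_subpath)
  have im\<gamma>: "path_image \<gamma> = \<gamma> ` {0..a} \<union> \<gamma> ` {a..b} \<union> \<gamma> ` {b..1}"
  proof -
    have "{0..1} = {0..a} \<union> {a..b} \<union> {b..1}" using ab by auto
    then show ?thesis by (metis image_Un path_image_def)
  qed
  define L where "L = (\<lambda>\<epsilon>::real. \<gamma> t + of_real \<epsilon> * (\<i> * d))"
  define R where "R = (\<lambda>\<epsilon>::real. \<gamma> t - of_real \<epsilon> * (\<i> * d))"
  have Re: "Re ((\<gamma> u - L \<epsilon>) / d) = Re ((\<gamma> u - \<gamma> t) / d)" "Re ((\<gamma> u - R \<epsilon>) / d) = Re ((\<gamma> u - \<gamma> t) / d)" for u \<epsilon>
    using d by (auto simp: L_def R_def add_divide_distrib diff_divide_distrib)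
  have limL: "(L \<longlongrightarrow> \<gamma> t) (at_right 0)" and limR: "(R \<longlongrightarrow> \<gamma> t) (at_right 0)"
    unfolding L_def R_def by (auto intro!: tendsto_eq_intros)
  have ii: "\<i> * (x * \<i>) = - x" for x
    by (simp add: complex_eq_iff)
  \<comment> \<open>With the factor \<open>\<i> / d\<close> the cut at \<open>L \<epsilon>\<close>
    runs along the left normal, away from the path. By the sign conditions the middle arc meets the
    normal line only at \<open>u = t\<close>, and there the value is \<open>\<epsilon> > 0\<close>.
    The factor \<open>- \<i> / d\<close> does the same for \<open>R \<epsilon>\<close> on the
    right.\<close>
  have slitL: "(\<i> / d) * (w - L \<epsilon>) \<notin> \<real>\<^sub>\<le>\<^sub>0" if e: "\<epsilon> > 0" and w: "w \<in> path_image \<gamma>2" for \<epsilon> w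
  proof
    obtain u where u: "w = \<gamma> u" "a \<le> u" "u \<le> b" using w im(2) by auto
    assume *: "(\<i> / d) * (w - L \<epsilon>) \<in> \<real>\<^sub>\<le>\<^sub>0"
    then have "Im ((\<i> / d) * (w - L \<epsilon>)) = 0"
      by (auto simp: complex_nonpos_Reals_iff)
    moreover have "(\<i> / d) * (w - L \<epsilon>) = \<i> * ((w - L \<epsilon>) / d)" by simp
    ultimately have "Re ((\<gamma> u - \<gamma> t) / d) = 0"
      using Re(1)[of u \<epsilon>] u by (metis Im_i_times)
    then have "u = t" using neg[of u] pos[of u] u by force
    then have "(\<i> / d) * (w - L \<epsilon>) = of_real \<epsilon>"
      using u d by (simp add: L_def ii)
    then show False using * e by (simp add: complex_nonpos_Reals_iff)
  qed
  have slitR: "(- \<i> / d) * (w - R \<epsilon>) \<notin> \<real>\<^sub>\<le>\<^sub>0" if e: "\<epsilon> > 0" and w: "w \<in> path_image \<gamma>2" for \<epsilon> w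
  proof
    obtain u where u: "w = \<gamma> u" "a \<le> u" "u \<le> b" using w im(2) by auto
    assume *: "(- \<i> / d) * (w - R \<epsilon>) \<in> \<real>\<^sub>\<le>\<^sub>0"
    then have "Im ((- \<i> / d) * (w - R \<epsilon>)) = 0"
      by (auto simp: complex_nonpos_Reals_iff)
    moreover have "(- \<i> / d) * (w - R \<epsilon>) = \<i> * (- ((w - R \<epsilon>) / d))" by simp
    ultimately have "Re (- ((w - R \<epsilon>) / d)) = 0"
      by (metis Im_i_times)
    then have "Re ((\<gamma> u - \<gamma> t) / d) = 0"
      using Re(2)[of u \<epsilon>] u by simp
    then have "u = t" using neg[of u] pos[of u] u by force
    then have "(- \<i> / d) * (w - R \<epsilon>) = of_real \<epsilon>"
      using u d by (simp add: R_def ii)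
    then show False using * e by (simp add: complex_nonpos_Reals_iff)
  qed
  define D where "D = (\<lambda>g \<epsilon>. winding_number g (L \<epsilon>) - winding_number g (R \<epsilon>))"
  \<comment> \<open>The outer arcs avoid the crossing point, so their winding numbers are continuous
    there and add nothing to the jump.\<close>
  have D0: "(D g \<longlongrightarrow> 0) (at_right 0)" if "path g" "\<gamma> t \<notin> path_image g" for g
  proof -
    have "isCont (winding_number g) (\<gamma> t)"
      using continuous_at_winding_number that by blast
    then have "((\<lambda>\<epsilon>. winding_number g (L \<epsilon>)) \<longlongrightarrow> winding_number g (\<gamma> t)) (at_right 0)"
      "((\<lambda>\<epsilon>. winding_number g (R \<epsilon>)) \<longlongrightarrow> winding_number g (\<gamma> t)) (at_right 0)"
      using limL limR isCont_tendsto_compose by blast+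
    then show ?thesis unfolding D_def by (auto intro!: tendsto_eq_intros)
  qed
  define wa wb where w_defs: "wa = (\<gamma> a - \<gamma> t) / d" "wb = (\<gamma> b - \<gamma> t) / d"
  have sgn: "Re wa < 0" "Re wb > 0" using neg[of a] pos[of b] ab by (auto simp: w_defs)
  have nR: "\<i> * x \<notin> \<real>\<^sub>\<le>\<^sub>0" "- \<i> * x \<notin> \<real>\<^sub>\<le>\<^sub>0" if "Re x \<noteq> 0" for x
    using that by (auto simp: complex_nonpos_Reals_iff)
  have D2: "(D \<gamma>2 \<longlongrightarrow> 1) (at_right 0)"
  proof -
    have eq: "D \<gamma>2 \<epsilon> = ((Ln (\<i> / d * (\<gamma> b - L \<epsilon>)) - Ln (\<i> / d * (\<gamma> a - L \<epsilon>))) -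
        (Ln (- \<i> / d * (\<gamma> b - R \<epsilon>)) - Ln (- \<i> / d * (\<gamma> a - R \<epsilon>)))) / (2 * of_real pi * \<i>)"
      if "\<epsilon> > 0" for \<epsilon>
    proof -
      have "pathstart \<gamma>2 = \<gamma> a" "pathfinish \<gamma>2 = \<gamma> b" by (auto simp: g_defs)
      then show ?thesis
        unfolding D_def diff_divide_distrib
        using winding_number_Ln[OF valid(2) _ slitL[OF that]] winding_number_Ln[OF valid(2) _ slitR[OF that]] d
        by (simp add: diff_divide_distrib)
    qed
    have lim: "((\<lambda>\<epsilon>. ((Ln (\<i> / d * (\<gamma> b - L \<epsilon>)) - Ln (\<i> / d * (\<gamma> a - L \<epsilon>))) -
        (Ln (- \<i> / d * (\<gamma> b - R \<epsilon>)) - Ln (- \<i> / d * (\<gamma> a - R \<epsilon>)))) / (2 * of_real pi * \<i>))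
      \<longlongrightarrow> ((Ln (\<i> / d * (\<gamma> b - \<gamma> t)) - Ln (\<i> / d * (\<gamma> a - \<gamma> t))) -
        (Ln (- \<i> / d * (\<gamma> b - \<gamma> t)) - Ln (- \<i> / d * (\<gamma> a - \<gamma> t)))) / (2 * of_real pi * \<i>)) (at_right 0)"
      using nR[of wa] nR[of wb] sgn
      by (intro tendsto_intros limL limR) (auto simp: w_defs)
    \<comment> \<open>Regrouping by endpoints gives a half turn from \<open>b\<close>, in front of
      the normal, minus the opposite half turn from \<open>a\<close>, behind it: together one full
      turn.\<close>
    have "(Ln (\<i> / d * (\<gamma> b - \<gamma> t)) - Ln (\<i> / d * (\<gamma> a - \<gamma> t))) -
        (Ln (- \<i> / d * (\<gamma> b - \<gamma> t)) - Ln (- \<i> / d * (\<gamma> a - \<gamma> t)))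
       = (Ln (\<i> * wb) - Ln (- \<i> * wb)) - (Ln (\<i> * wa) - Ln (- \<i> * wa))"
      by (simp add: w_defs)
    also have "\<dots> = 2 * of_real pi * \<i>"
      using sgn by (subst (1 2) Ln_ii_diff) auto
    finally have "((\<lambda>\<epsilon>. ((Ln (\<i> / d * (\<gamma> b - L \<epsilon>)) - Ln (\<i> / d * (\<gamma> a - L \<epsilon>))) -
        (Ln (- \<i> / d * (\<gamma> b - R \<epsilon>)) - Ln (- \<i> / d * (\<gamma> a - R \<epsilon>)))) / (2 * of_real pi * \<i>))
      \<longlongrightarrow> 1) (at_right 0)"
      using lim by simp
    then show ?thesis
      by (rule Lim_transform_eventually) (auto simp: eq eventually_at_right_less intro!: eventually_at_right_less[THEN eventually_mono])
  qed
  have lim: "((\<lambda>\<epsilon>. D \<gamma>1 \<epsilon> + D \<gamma>2 \<epsilon> + D \<gamma>3 \<epsilon>) \<longlongrightarrow> 0 + 1 + 0) (at_right 0)"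
    using off valid by (intro tendsto_add D0 D2) (auto simp: im valid_path_imp_path)
  have "open (- (path_image \<gamma>1 \<union> path_image \<gamma>3))" "\<gamma> t \<in> - (path_image \<gamma>1 \<union> path_image \<gamma>3)"
    using off valid by (auto simp: im[symmetric] image_Un intro!: open_Compl closed_Un closed_valid_path_image)
  then have "\<forall>\<^sub>F \<epsilon> in at_right 0. L \<epsilon> \<in> - (path_image \<gamma>1 \<union> path_image \<gamma>3)"
     "\<forall>\<^sub>F \<epsilon> in at_right 0. R \<epsilon> \<in> - (path_image \<gamma>1 \<union> path_image \<gamma>3)"
    using limL limR topological_tendstoD by blast+
  then have "\<forall>\<^sub>F \<epsilon> in at_right 0. D \<gamma>1 \<epsilon> + D \<gamma>2 \<epsilon> + D \<gamma>3 \<epsilon> = D \<gamma> \<epsilon>"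
    using eventually_at_right_less[of "0::real"]
  proof eventually_elim
    case (elim \<epsilon>)
    have "L \<epsilon> \<notin> path_image \<gamma>2" "R \<epsilon> \<notin> path_image \<gamma>2"
      using slitL[OF elim(3), of "L \<epsilon>"] slitR[OF elim(3), of "R \<epsilon>"] by auto
    then have "L \<epsilon> \<notin> path_image \<gamma>" "R \<epsilon> \<notin> path_image \<gamma>"
      using elim unfolding im\<gamma> im[symmetric] by auto
    then have "winding_number \<gamma>1 z + winding_number \<gamma>2 z + winding_number \<gamma>3 z = winding_number \<gamma> z"
      if "z \<in> {L \<epsilon>, R \<epsilon>}" for z
      using that ab path winding_number_subpath_combine[of \<gamma> z 0 a b]
        winding_number_subpath_combine[of \<gamma> z 0 b 1] by (auto simp: g_defs)
    then show ?case by (simp add: D_def algebra_simps)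
  qed
  then have "(D \<gamma> \<longlongrightarrow> 1) (at_right 0)"
    using Lim_transform_eventually[OF lim] by simp
  then show ?thesis by (simp add: D_def[abs_def] L_def R_def)
qed

section \<open>Smooth Jordan curves\<close>

definition unit_path :: "(real \<Rightarrow> complex) \<Rightarrow> real \<Rightarrow> complex" where
  "unit_path h x = h (2 * pi * x)"

text \<open>The normal keeps the length of the derivative, so that for small \<open>s > 0\<close>
  these are exactly the points of which \<open>lies_left_of\<close> speaks; negative
  \<open>s\<close> moves to the right of the curve.\<close>

definition normal_shift :: "(real \<Rightarrow> complex) \<Rightarrow> real \<Rightarrow> real \<Rightarrow> complex" where
  "normal_shift e s t = e t + of_real s * (\<i> * vector_derivative e (at t))"

lemma path_image_unit_path: "path_image (unit_path h) = curve_trace h"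
proof -
  have "(\<lambda>x. 2 * pi * x) ` {0..1} = {0..2 * pi}"
    using image_mult_atLeastAtMost[of "2 * pi" 0 1] by simp
  moreover have "path_image (unit_path h) = h ` ((\<lambda>x. 2 * pi * x) ` {0..1})"
    by (simp only: path_image_def unit_path_def[abs_def] image_image)
  ultimately show ?thesis
    by (simp add: curve_trace_def)
qed

lemma has_vector_derivative_unit_path:
  assumes "(h has_vector_derivative D) (at (2 * pi * x))"
  shows "(unit_path h has_vector_derivative (2 * pi) *\<^sub>R D) (at x)"
proof -
  have "((\<lambda>x. 2 * pi * x) has_vector_derivative 2 * pi) (at x)"
    by (auto intro!: derivative_eq_intros simp: has_real_derivative_iff_has_vector_derivative[symmetric])
  from vector_diff_chain_at[OF this] assms show ?thesis
    by (simp add: o_def unit_path_def[abs_def])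
qed

lemma valid_path_unit_path:
  assumes "h C1_differentiable_on UNIV"
  shows "valid_path (unit_path h)"
proof -
  obtain D where D: "\<And>x. (h has_vector_derivative D x) (at x)" "continuous_on UNIV D"
    using assms by (auto simp: C1_differentiable_on_def)
  have "continuous_on UNIV (\<lambda>x. (2 * pi) *\<^sub>R D (2 * pi * x))"
    by (intro continuous_intros continuous_on_compose2[OF D(2)]) auto
  then have "unit_path h C1_differentiable_on {0..1}"
    unfolding C1_differentiable_on_def
    by (intro exI[of _ "\<lambda>x. (2 * pi) *\<^sub>R D (2 * pi * x)"])
       (auto intro: has_vector_derivative_unit_path D(1) continuous_on_subset)
  then show ?thesis
    by (simp add: C1_differentiable_imp_piecewise valid_path_def)
qed

lemma contour_integral_unit_path:
  assumes "\<And>t. h differentiable at t"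
  shows "contour_integral (unit_path h) f = integral {0..2 * pi} (\<lambda>t. f (h t) * vector_derivative h (at t))"
proof -
  let ?F = "\<lambda>t. f (h t) * vector_derivative h (at t)"
  have "vector_derivative (unit_path h) (at x) = (2 * pi) *\<^sub>R vector_derivative h (at (2 * pi * x))" for x
    using has_vector_derivative_unit_path[of h _ x] assms vector_derivative_at vector_derivative_works
    by blast
  then have "contour_integral (unit_path h) f = integral {0..1} (\<lambda>x. (2 * pi) *\<^sub>R ?F (2 * pi * x))"
    by (simp add: contour_integral_integral unit_path_def)
  also have "\<dots> = (2 * pi) *\<^sub>R integral {0..1} (\<lambda>x. ?F (2 * pi * x))"
    by (rule integral_cmul)
  also have "(\<lambda>x. x / (2 * pi)) ` {0..2 * pi} = {0..1}"
    using image_mult_atLeastAtMost[of "1 / (2 * pi)" 0 "2 * pi"] by simp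
  then have "integral {0..1} (\<lambda>x. ?F (2 * pi * x)) = (1 / (2 * pi)) *\<^sub>R integral {0..2 * pi} ?F"
    using integral_stretch_real[of "2 * pi" 0 "2 * pi" ?F] by simp
  finally show ?thesis by simp
qed

lemma reduce_mod_period: obtains n :: int where "t - 2 * pi * of_int n \<in> {0..<2 * pi}"
proof -
  have "of_int \<lfloor>t / (2 * pi)\<rfloor> \<le> t / (2 * pi)" "t / (2 * pi) < of_int \<lfloor>t / (2 * pi)\<rfloor> + 1"
    by linarith+
  then have "of_int \<lfloor>t / (2 * pi)\<rfloor> * (2 * pi) \<le> t" "t < (of_int \<lfloor>t / (2 * pi)\<rfloor> + 1) * (2 * pi)"
    by (simp_all only: pos_le_divide_eq pos_divide_less_eq pi_gt_zero zero_less_mult_iff zero_less_numeral simp_thms)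
  then have "t - 2 * pi * of_int \<lfloor>t / (2 * pi)\<rfloor> \<in> {0..<2 * pi}"
    by (simp add: algebra_simps)
  then show thesis using that by blast
qed

context
  fixes e :: "real \<Rightarrow> complex"
  assumes e: "smooth_jordan_param e"
begin

lemma smooth_jordan_derivative: "(e has_vector_derivative vector_derivative e (at t)) (at t)"
  using e by (simp add: smooth_jordan_param_def vector_derivative_works)

lemma smooth_jordan_continuous: "continuous_on S e"
  by (meson smooth_jordan_derivative continuous_at_imp_continuous_on has_vector_derivative_continuous)

lemma smooth_jordan_deriv_continuous: "continuous_on S (\<lambda>t. vector_derivative e (at t))"
  using e unfolding smooth_jordan_param_def
  by (meson C1_differentiable_imp_continuous_on continuous_on_subset subset_UNIV)

lemma smooth_jordan_shift_period: "e (t + 2 * pi * of_int n) = e t"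
proof -
  have nat: "e (t + 2 * pi * real k) = e t" for t k
  proof (induction k)
    case (Suc k)
    have "e (t + 2 * pi * real (Suc k)) = e ((t + 2 * pi * real k) + 2 * pi)"
      by (simp add: algebra_simps)
    then show ?case using e Suc by (simp add: smooth_jordan_param_def)
  qed simp
  show ?thesis
  proof (cases "n \<ge> 0")
    case True
    then show ?thesis using nat[of t "nat n"] by simp
  next
    case False
    then show ?thesis using nat[of "t + 2 * pi * of_int n" "nat (- n)"] by simp
  qed
qed

lemma smooth_jordan_deriv_shift_period:
  "vector_derivative e (at (t + 2 * pi * of_int n)) = vector_derivative e (at t)"
proof -
  have "((\<lambda>x. x + 2 * pi * of_int n) has_vector_derivative 1) (at t)"
    by (auto intro!: derivative_eq_intros simp: has_real_derivative_iff_has_vector_derivative[symmetric])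
  from vector_diff_chain_at[OF this smooth_jordan_derivative]
  have "(e has_vector_derivative vector_derivative e (at (t + 2 * pi * of_int n))) (at t)"
    by (simp add: o_def smooth_jordan_shift_period)
  then show ?thesis using vector_derivative_at by metis
qed

text \<open>Injectivity on one period makes \<open>u - t\<close> a multiple of 2 pi, and the bound
  leaves only 0. A window centred at \<open>t\<close> spares a separate treatment of the point where
  the curve closes.\<close>

lemma smooth_jordan_eq_imp:
  assumes "e t = e u" "\<bar>u - t\<bar> \<le> pi"
  shows "u = t"
proof -
  obtain m where m: "t - 2 * pi * of_int m \<in> {0..<2 * pi}" by (rule reduce_mod_period)
  obtain n where n: "u - 2 * pi * of_int n \<in> {0..<2 * pi}" by (rule reduce_mod_period)
  have "e (t - 2 * pi * of_int m) = e (u - 2 * pi * of_int n)"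
    using smooth_jordan_shift_period[of t "-m"] smooth_jordan_shift_period[of u "-n"] assms by simp
  then have "t - 2 * pi * of_int m = u - 2 * pi * of_int n"
    using e m n by (auto simp: smooth_jordan_param_def inj_on_def)
  then have *: "u - t = 2 * pi * of_int (n - m)" by (simp add: algebra_simps)
  with assms have "2 * pi * \<bar>of_int (n - m)\<bar> \<le> pi * 1" by (simp add: abs_mult)
  then have "2 * \<bar>real_of_int (n - m)\<bar> \<le> 1" by (simp add: mult.commute mult.left_commute)
  then have "real_of_int (2 * \<bar>n - m\<bar>) \<le> real_of_int 1" by simp
  then have "2 * \<bar>n - m\<bar> \<le> 1" by (simp only: of_int_le_iff)
  then have "n - m = 0" by arith
  with * show ?thesis by simp
qed

lemma curve_trace_eq_range: "curve_trace e = range e"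
proof -
  have "e t \<in> curve_trace e" for t
  proof -
    obtain n where n: "t - 2 * pi * of_int n \<in> {0..<2 * pi}" by (rule reduce_mod_period)
    then show ?thesis
      using smooth_jordan_shift_period[of t "-n"] unfolding curve_trace_def
      by (intro image_eqI[of _ _ "t - 2 * pi * of_int n"]) auto
  qed
  then show ?thesis by (auto simp: curve_trace_def)
qed

lemma smooth_jordan_path:
  shows "valid_path (unit_path e)" "pathfinish (unit_path e) = pathstart (unit_path e)"
    "simple_path (unit_path e)"
proof -
  have "e C1_differentiable_on UNIV"
    using e smooth_jordan_deriv_continuous by (auto simp: C1_differentiable_on_eq smooth_jordan_param_def)
  then show v: "valid_path (unit_path e)" by (rule valid_path_unit_path)
  show "pathfinish (unit_path e) = pathstart (unit_path e)"
    using smooth_jordan_shift_period[of 0 1] by (simp add: pathfinish_def pathstart_def unit_path_def)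
  have inj: "x = y" if "x \<in> {0..<1}" "y \<in> {0..<1}" "unit_path e x = unit_path e y" for x y
  proof -
    have "2 * pi * x \<in> {0..<2 * pi}" "2 * pi * y \<in> {0..<2 * pi}" using that by auto
    moreover have "inj_on e {0..<2 * pi}" using e by (simp add: smooth_jordan_param_def)
    ultimately have "2 * pi * x = 2 * pi * y"
      using that by (metis inj_onD unit_path_def)
    then show ?thesis by simp
  qed
  have loop: "unit_path e 1 = unit_path e 0"
    using smooth_jordan_shift_period[of 0 1] by (simp add: unit_path_def)
  have "loop_free (unit_path e)"
    unfolding loop_free_def
  proof (intro ballI impI)
    fix x y :: real assume *: "x \<in> {0..1}" "y \<in> {0..1}" "unit_path e x = unit_path e y"
    consider "x < 1" "y < 1" | "x = 1" "y < 1" | "x < 1" "y = 1" | "x = 1" "y = 1" using * by force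
    then show "x = y \<or> x = 0 \<and> y = 1 \<or> x = 1 \<and> y = 0"
    proof cases
      case 1
      then show ?thesis using inj[of x y] * by simp
    next
      case 2
      then show ?thesis using inj[of 0 y] * loop by simp
    next
      case 3
      then show ?thesis using inj[of x 0] * loop by simp
    qed simp
  qed
  then show "simple_path (unit_path e)"
    using v by (simp add: simple_path_def valid_path_imp_path)
qed

text \<open>The second derivative of the curve enters here; its continuity makes the shifted curve
  C1 and thus a valid path of integration.\<close>

lemma normal_shift_derivative:
  "(normal_shift e s has_vector_derivative
      vector_derivative e (at t) + of_real s * (\<i> * vector_derivative (\<lambda>t. vector_derivative e (at t)) (at t))) (at t)"
proof -
  have "((\<lambda>t. vector_derivative e (at t)) has_vector_derivative
      vector_derivative (\<lambda>t. vector_derivative e (at t)) (at t)) (at t)"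
    using e by (simp add: smooth_jordan_param_def C1_differentiable_on_eq vector_derivative_works)
  then show ?thesis
    unfolding normal_shift_def[abs_def]
    by (intro has_vector_derivative_add smooth_jordan_derivative has_vector_derivative_mult_right)
qed

lemma smooth_jordan_second_deriv_continuous:
  "continuous_on S (\<lambda>t. vector_derivative (\<lambda>t. vector_derivative e (at t)) (at t))"
  using e unfolding smooth_jordan_param_def C1_differentiable_on_eq
  by (meson continuous_on_subset subset_UNIV)

lemma normal_shift_path:
  shows "valid_path (unit_path (normal_shift e s))"
    "pathfinish (unit_path (normal_shift e s)) = pathstart (unit_path (normal_shift e s))"
proof -
  have "continuous_on UNIV (\<lambda>t. vector_derivative e (at t) +
      of_real s * (\<i> * vector_derivative (\<lambda>t. vector_derivative e (at t)) (at t)))"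
    by (intro continuous_intros smooth_jordan_deriv_continuous smooth_jordan_second_deriv_continuous)
  then have "normal_shift e s C1_differentiable_on UNIV"
    unfolding C1_differentiable_on_def
    by (intro exI[of _ "\<lambda>t. vector_derivative e (at t) +
      of_real s * (\<i> * vector_derivative (\<lambda>t. vector_derivative e (at t)) (at t))"])
       (auto intro: normal_shift_derivative)
  then show "valid_path (unit_path (normal_shift e s))" by (rule valid_path_unit_path)
  show "pathfinish (unit_path (normal_shift e s)) = pathstart (unit_path (normal_shift e s))"
    using smooth_jordan_shift_period[of 0 1] smooth_jordan_deriv_shift_period[of 0 1]
    by (simp add: pathfinish_def pathstart_def unit_path_def normal_shift_def)
qed

text \<open>By uniform continuity the derivative varies by less than half of its smallest modulus
  over short distances, and the mean value inequality carries this over to the curve. The relative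
  error 1/2 is below 1, so on its scale the curve cannot turn away from its tangent.\<close>

lemma tangent_estimate:
  "\<exists>\<delta>>0. \<forall>t\<in>{0..2 * pi}. \<forall>u. \<bar>u - t\<bar> < \<delta> \<longrightarrow>
     cmod (e u - e t - of_real (u - t) * vector_derivative e (at t))
       \<le> \<bar>u - t\<bar> * (cmod (vector_derivative e (at t)) / 2)"
proof -
  let ?e' = "\<lambda>t. vector_derivative e (at t)"
  \<comment> \<open>One unit is added on both sides because \<open>u\<close> may leave the period;
    the bound \<open>min \<delta> 1\<close> keeps it in \<open>C\<close>.\<close>
  define C where "C = {-1..2 * pi + 1}"
  have "compact C" "C \<noteq> {}" by (auto simp: C_def)
  have "continuous_on C (\<lambda>t. cmod (?e' t))"
    by (intro continuous_intros smooth_jordan_deriv_continuous)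
  from continuous_attains_inf[OF \<open>compact C\<close> \<open>C \<noteq> {}\<close> this]
  obtain t0 where t0: "\<And>t. t \<in> C \<Longrightarrow> cmod (?e' t0) \<le> cmod (?e' t)" by auto
  have "cmod (?e' t0) > 0" using e by (simp add: smooth_jordan_param_def)
  moreover have "uniformly_continuous_on C ?e'"
    using \<open>compact C\<close> compact_uniformly_continuous smooth_jordan_deriv_continuous by blast
  ultimately obtain \<delta> where \<delta>: "\<delta> > 0"
    "\<And>t v. t \<in> C \<Longrightarrow> v \<in> C \<Longrightarrow> dist v t < \<delta> \<Longrightarrow> dist (?e' v) (?e' t) < cmod (?e' t0) / 2"
    unfolding uniformly_continuous_on_def by (metis half_gt_zero)
  show ?thesis
  proof (intro exI[of _ "min \<delta> 1"] conjI ballI allI impI)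
    fix t u :: real assume t: "t \<in> {0..2 * pi}" and u: "\<bar>u - t\<bar> < min \<delta> 1"
    have "cmod (?e' v - ?e' t) \<le> cmod (?e' t) / 2" if "v \<in> closed_segment t u" for v
    proof -
      have "\<bar>v - t\<bar> \<le> \<bar>u - t\<bar>" using that by (auto simp: closed_segment_eq_real_ivl split: if_splits)
      then have "v \<in> C" "t \<in> C" "dist v t < \<delta>" using t u by (auto simp: C_def dist_real_def)
      then show ?thesis using \<delta>(2)[of t v] t0[of t] by (auto simp: dist_norm)
    qed
    then have "norm (e u - e t - (u - t) *\<^sub>R ?e' t) \<le> norm (u - t) * (cmod (?e' t) / 2)"
      by (intro vector_differentiable_bound_linearization[where S = "closed_segment t u"])
         (auto intro: smooth_jordan_derivative has_vector_derivative_at_within)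
    then show "cmod (e u - e t - of_real (u - t) * ?e' t) \<le> \<bar>u - t\<bar> * (cmod (?e' t) / 2)"
      by (simp add: scaleR_conv_of_real)
  qed (use \<delta> in auto)
qed

text \<open>A coincidence \<open>e u = e t + s \<i> e'(t)\<close> with \<open>u\<close> near \<open>t\<close> contradicts the tangent
  estimate, since \<open>u - t\<close> is real and \<open>s \<i>\<close> imaginary; if \<open>u\<close> is far from \<open>t\<close>, then
  compactness bounds \<open>e u - e t\<close> away from \<open>0\<close>.\<close>

lemma normal_shift_off_curve:
  "\<exists>\<epsilon>>0. \<forall>s t. 0 < \<bar>s\<bar> \<and> \<bar>s\<bar> < \<epsilon> \<longrightarrow> normal_shift e s t \<notin> curve_trace e"
proof -
  let ?e' = "\<lambda>t. vector_derivative e (at t)"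
  obtain \<delta> where "\<delta> > 0" and \<delta>:
    "\<And>t u. t \<in> {0..2 * pi} \<Longrightarrow> \<bar>u - t\<bar> < \<delta> \<Longrightarrow>
       cmod (e u - e t - of_real (u - t) * ?e' t) \<le> \<bar>u - t\<bar> * (cmod (?e' t) / 2)"
    using tangent_estimate by blast
  \<comment> \<open>The pairs of parameters that are neither close nor more than half a period
    apart. On this compact set \<open>e u - e t\<close> has no zero, which yields the distance
    \<open>c\<close>.\<close>
  define F where "F = ({0..2 * pi} \<times> {- pi..3 * pi}) \<inter> {x. \<delta> \<le> \<bar>snd x - fst x\<bar>} \<inter> {x. \<bar>snd x - fst x\<bar> \<le> pi}"
  have "compact F" unfolding F_def
    by (intro compact_Int_closed compact_Times closed_Collect_le continuous_intros) auto
  moreover have "continuous_on F (\<lambda>x. e (snd x) - e (fst x))"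
    by (intro continuous_intros continuous_on_compose2[OF smooth_jordan_continuous[of UNIV]]) auto
  ultimately have "closed ((\<lambda>x. e (snd x) - e (fst x)) ` F)"
    using compact_continuous_image compact_imp_closed by blast
  moreover have "0 \<notin> (\<lambda>x. e (snd x) - e (fst x)) ` F"
  proof
    assume "0 \<in> (\<lambda>x. e (snd x) - e (fst x)) ` F"
    then obtain t u where *: "(t, u) \<in> F" "e t = e u" by auto
    then have "u = t" using smooth_jordan_eq_imp[of t u] by (auto simp: F_def)
    then show False using * \<open>\<delta> > 0\<close> by (auto simp: F_def)
  qed
  ultimately have "\<exists>c>0. \<forall>w\<in>(\<lambda>x. e (snd x) - e (fst x)) ` F. c \<le> dist 0 w"
    by (rule separate_point_closed)
  then obtain c where "c > 0" and c': "\<forall>w\<in>(\<lambda>x. e (snd x) - e (fst x)) ` F. c \<le> dist 0 w"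
    by (elim exE conjE)
  have c: "c \<le> cmod (e u - e t)" if "(t, u) \<in> F" for t u
    using bspec[OF c' imageI[OF that]] by simp
  have "compact (?e' ` {0..2 * pi})"
    by (intro compact_continuous_image smooth_jordan_deriv_continuous) auto
  from compact_imp_bounded[OF this]
  obtain M where "M > 0" and M': "\<forall>w\<in>?e' ` {0..2 * pi}. cmod w \<le> M"
    unfolding bounded_pos by (elim exE conjE)
  have M: "cmod (?e' t) \<le> M" if "t \<in> {0..2 * pi}" for t
    using bspec[OF M' imageI[OF that]] .
  show ?thesis
  proof (intro exI[of _ "c / M"] conjI allI impI)
    fix s t0 :: real assume s: "0 < \<bar>s\<bar> \<and> \<bar>s\<bar> < c / M"
    show "normal_shift e s t0 \<notin> curve_trace e"
    proof
      assume mem: "normal_shift e s t0 \<in> curve_trace e"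
      obtain m where m: "t0 - 2 * pi * of_int m \<in> {0..<2 * pi}" by (rule reduce_mod_period)
      define t where "t = t0 - 2 * pi * of_int m"
      have t: "t \<in> {0..2 * pi}" using m by (auto simp: t_def)
      have "normal_shift e s t = normal_shift e s t0"
        unfolding t_def normal_shift_def
        using smooth_jordan_shift_period[of t0 "-m"] smooth_jordan_deriv_shift_period[of t0 "-m"] by simp
      with mem obtain v where v: "normal_shift e s t = e v"
        unfolding curve_trace_eq_range by auto
      \<comment> \<open>The representative of \<open>v\<close> modulo the period that is nearest to
        \<open>t\<close>.\<close>
      define u where "u = v - 2 * pi * of_int (round ((v - t) / (2 * pi)))"
      have "u - t = 2 * pi * ((v - t) / (2 * pi) - of_int (round ((v - t) / (2 * pi))))"
        by (simp add: u_def field_simps)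
      moreover have "\<bar>(v - t) / (2 * pi) - of_int (round ((v - t) / (2 * pi)))\<bar> \<le> 1 / 2"
        using of_int_round_abs_le[of "(v - t) / (2 * pi)"] by (simp add: abs_minus_commute)
      ultimately have ut: "\<bar>u - t\<bar> \<le> pi"
        by (simp add: abs_mult)
      have "e u = e v"
        using smooth_jordan_shift_period[of v "- round ((v - t) / (2 * pi))"] by (simp add: u_def)
      then have eu: "e u - e t = of_real s * (\<i> * ?e' t)"
        using v by (simp add: normal_shift_def algebra_simps)
      have ne: "?e' t \<noteq> 0" using e by (simp add: smooth_jordan_param_def)
      show False
      proof (cases "\<bar>u - t\<bar> < \<delta>")
        case True
        \<comment> \<open>The modulus of this complex number is at least
          \<open>\<bar>u - t\<bar>\<close>, while the tangent estimate allows only half of that.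
          Hence it vanishes, and \<open>s\<close> with it.\<close>
        have "of_real s * (\<i> * ?e' t) - of_real (u - t) * ?e' t = Complex (- (u - t)) s * ?e' t"
          by (simp add: complex_eq_iff algebra_simps)
        then have "cmod (Complex (- (u - t)) s) * cmod (?e' t) \<le> \<bar>u - t\<bar> * (cmod (?e' t) / 2)"
          using \<delta>[OF t True] eu by (simp add: norm_mult)
        then have "cmod (Complex (- (u - t)) s) * cmod (?e' t) \<le> (\<bar>u - t\<bar> / 2) * cmod (?e' t)"
          by simp
        then have le: "cmod (Complex (- (u - t)) s) \<le> \<bar>u - t\<bar> / 2"
          using ne by (metis mult_le_cancel_right_pos zero_less_norm_iff)
        have "\<bar>u - t\<bar> \<le> cmod (Complex (- (u - t)) s)" "\<bar>s\<bar> \<le> cmod (Complex (- (u - t)) s)"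
          using abs_Re_le_cmod[of "Complex (- (u - t)) s"] abs_Im_le_cmod[of "Complex (- (u - t)) s"] by auto
        then show False using le s by auto
      next
        case False
        then have "(t, u) \<in> F" using t ut by (auto simp: F_def)
        then have "c \<le> \<bar>s\<bar> * cmod (?e' t)" using c[of t u] eu by (simp add: norm_mult)
        also have "\<dots> \<le> \<bar>s\<bar> * M" using M[OF t] by (intro mult_left_mono) auto
        also have "\<dots> < c" using s \<open>M > 0\<close> by (simp add: field_simps)
        finally show False by simp
      qed
    qed
  qed (use \<open>c > 0\<close> \<open>M > 0\<close> in auto)
qed

text \<open>One crossing decides the orientation, since a simple closed path has constant winding
  number 1 or -1 on its inside. The parameter \<open>pi\<close> becomes the midpoint of
  \<open>unit_path e\<close>, away from the closing point.\<close>

lemma winding_number_inside_of_left_outside: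
  assumes left: "\<forall>\<^sub>F \<epsilon> in at_right 0. normal_shift e \<epsilon> pi \<in> outside (curve_trace e)"
    and z: "z \<in> inside (curve_trace e)"
  shows "winding_number (unit_path e) z = -1"
proof -
  let ?\<gamma> = "unit_path e"
  define d where "d = vector_derivative e (at pi)"
  have d: "d \<noteq> 0" using e by (simp add: d_def smooth_jordan_param_def)
  obtain \<delta> where "\<delta> > 0" and \<delta>:
    "\<And>t u. t \<in> {0..2 * pi} \<Longrightarrow> \<bar>u - t\<bar> < \<delta> \<Longrightarrow>
       cmod (e u - e t - of_real (u - t) * vector_derivative e (at t)) \<le> \<bar>u - t\<bar> * (cmod (vector_derivative e (at t)) / 2)"
    using tangent_estimate by blast
  \<comment> \<open>Division by \<open>d\<close> turns the tangent into the real axis, so the real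
    part follows \<open>u - pi\<close> with relative error 1/2 and shares its sign.\<close>
  have near: "\<bar>Re ((e u - e pi) / d) - (u - pi)\<bar> \<le> \<bar>u - pi\<bar> / 2" if "\<bar>u - pi\<bar> < \<delta>" for u
  proof -
    have "(e u - e pi) / d - of_real (u - pi) = (e u - e pi - of_real (u - pi) * d) / d"
      using d by (simp add: field_simps)
    moreover have "cmod ((e u - e pi - of_real (u - pi) * d) / d) \<le> \<bar>u - pi\<bar> / 2"
      using \<delta>[of pi u] that d by (simp add: d_def norm_divide field_simps)
    ultimately have "cmod ((e u - e pi) / d - of_real (u - pi)) \<le> \<bar>u - pi\<bar> / 2" by simp
    moreover have "\<bar>Re ((e u - e pi) / d) - (u - pi)\<bar> \<le> cmod ((e u - e pi) / d - of_real (u - pi))"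
      using abs_Re_le_cmod[of "(e u - e pi) / d - of_real (u - pi)"] by simp
    ultimately show ?thesis by linarith
  qed
  have sign: "\<bar>y - x\<bar> \<le> \<bar>x\<bar> / 2 \<Longrightarrow> x < 0 \<Longrightarrow> y < 0"
    "\<bar>y - x\<bar> \<le> \<bar>x\<bar> / 2 \<Longrightarrow> x > 0 \<Longrightarrow> y > 0" for x y :: real
    by linarith+
  \<comment> \<open>The bound 1/4 keeps the arc around 1/2 within the unit interval; the other makes
    its length in the original parameter at most \<open>\<delta> / 2\<close> on either side.\<close>
  define r where "r = min (1 / 4) (\<delta> / (4 * pi))"
  have r: "r > 0" "r < 1 / 2" "2 * pi * r < \<delta>"
  proof -
    have "2 * pi * r \<le> 2 * pi * (\<delta> / (4 * pi))" unfolding r_def by (intro mult_left_mono) auto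
    also have "\<dots> < \<delta>" using \<open>\<delta> > 0\<close> by simp
    finally show "2 * pi * r < \<delta>" .
  qed (use \<open>\<delta> > 0\<close> in \<open>auto simp: r_def\<close>)
  have close: "\<bar>2 * pi * u - pi\<bar> < \<delta>" if "\<bar>u - 1 / 2\<bar> \<le> r" for u
  proof -
    have "2 * pi * u - pi = 2 * pi * (u - 1 / 2)" by (simp add: algebra_simps)
    then have "\<bar>2 * pi * u - pi\<bar> = 2 * pi * \<bar>u - 1 / 2\<bar>" by (simp add: abs_mult)
    also have "\<dots> \<le> 2 * pi * r" using that by (intro mult_left_mono) auto
    finally show ?thesis using r by simp
  qed
  have jump: "((\<lambda>\<epsilon>. winding_number ?\<gamma> (?\<gamma> (1 / 2) + of_real \<epsilon> * (\<i> * d)) -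
      winding_number ?\<gamma> (?\<gamma> (1 / 2) - of_real \<epsilon> * (\<i> * d))) \<longlongrightarrow> 1) (at_right 0)"
  proof (rule winding_number_jump[OF smooth_jordan_path(1), where a = "1 / 2 - r" and b = "1 / 2 + r"])
    fix u assume u: "1 / 2 - r \<le> u" "u < 1 / 2"
    then have "2 * pi * u < 2 * pi * (1 / 2)" by (intro mult_strict_left_mono) auto
    then have "2 * pi * u - pi < 0" by simp
    have "\<bar>u - 1 / 2\<bar> \<le> r" using u by linarith
    from near[OF close[OF this]] \<open>2 * pi * u - pi < 0\<close>
    have "Re ((e (2 * pi * u) - e pi) / d) < 0" by (rule sign)
    then show "Re ((?\<gamma> u - ?\<gamma> (1 / 2)) / d) < 0" by (simp add: unit_path_def)
  next
    fix u assume u: "1 / 2 < u" "u \<le> 1 / 2 + r"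
    then have "2 * pi * u > 2 * pi * (1 / 2)" by (intro mult_strict_left_mono) auto
    then have "2 * pi * u - pi > 0" by simp
    have "\<bar>u - 1 / 2\<bar> \<le> r" using u by linarith
    from near[OF close[OF this]] \<open>2 * pi * u - pi > 0\<close>
    have "Re ((e (2 * pi * u) - e pi) / d) > 0" by (rule sign)
    then show "Re ((?\<gamma> u - ?\<gamma> (1 / 2)) / d) > 0" by (simp add: unit_path_def)
  next
    show "?\<gamma> (1 / 2) \<notin> ?\<gamma> ` ({0..1 / 2 - r} \<union> {1 / 2 + r..1})"
    proof
      assume "?\<gamma> (1 / 2) \<in> ?\<gamma> ` ({0..1 / 2 - r} \<union> {1 / 2 + r..1})"
      then obtain y where y: "y \<in> {0..1 / 2 - r} \<union> {1 / 2 + r..1}" "?\<gamma> (1 / 2) = ?\<gamma> y"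
        by (elim imageE)
      have "loop_free ?\<gamma>" using smooth_jordan_path(3) by (simp add: simple_path_def)
      then have "\<forall>y\<in>{0..1}. ?\<gamma> (1 / 2) = ?\<gamma> y \<longrightarrow> 1 / 2 = y"
        unfolding loop_free_def by (rule ballE[of _ _ "1 / 2"]) auto
      moreover have "y \<in> {0..1}" using y r by auto
      ultimately have "y = 1 / 2" using y(2) by metis
      then show False using y(1) r by auto
    qed
  qed (use r d in auto)
  have half: "?\<gamma> (1 / 2) = e pi" by (simp add: unit_path_def)
  obtain \<epsilon>0 where "\<epsilon>0 > 0" and
    off: "\<And>s t. 0 < \<bar>s\<bar> \<Longrightarrow> \<bar>s\<bar> < \<epsilon>0 \<Longrightarrow> normal_shift e s t \<notin> curve_trace e"
    using normal_shift_off_curve by blast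
  have "\<forall>\<^sub>F \<epsilon> in at_right 0. \<epsilon> < \<epsilon>0"
    using \<open>\<epsilon>0 > 0\<close> eventually_at_right_real[of 0 \<epsilon>0] by (auto elim: eventually_mono)
  with left tendstoD[OF jump half_gt_zero[OF zero_less_one]] eventually_at_right_less[of "0::real"]
  have "\<forall>\<^sub>F \<epsilon>::real in at_right 0. \<exists>w\<in>inside (curve_trace e). winding_number ?\<gamma> w = -1"
  proof eventually_elim
    case (elim \<epsilon>)
    let ?w = "normal_shift e (- \<epsilon>) pi"
    have L: "winding_number ?\<gamma> (e pi + of_real \<epsilon> * (\<i> * d)) = 0"
      using elim smooth_jordan_path
      by (intro winding_number_zero_in_outside)
         (auto simp: path_image_unit_path normal_shift_def d_def valid_path_imp_path)
    have "?w = e pi - of_real \<epsilon> * (\<i> * d)" by (simp add: normal_shift_def d_def)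
    \<comment> \<open>The winding number is 0 on the left, so that on the right is within 1/2 of -1;
      as it can only be -1, 0 or 1, it equals -1.\<close>
    then have dist: "cmod (- winding_number ?\<gamma> ?w - 1) < 1 / 2"
      using elim L half by (simp add: dist_norm)
    have w: "?w \<notin> curve_trace e" using elim by (intro off) auto
    then have "winding_number ?\<gamma> ?w \<in> {-1, 0, 1}"
      using smooth_jordan_path by (intro simple_closed_path_winding_number_cases) (auto simp: path_image_unit_path)
    with dist have m1: "winding_number ?\<gamma> ?w = -1" by auto
    then have "?w \<notin> outside (curve_trace e)"
      using winding_number_zero_in_outside[of ?\<gamma> ?w] smooth_jordan_path
      by (auto simp: path_image_unit_path valid_path_imp_path)
    then have "?w \<in> inside (curve_trace e)" using w by (metis ComplI UnE inside_Un_outside)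
    with m1 show ?case by blast
  qed
  then obtain w where w: "w \<in> inside (curve_trace e)" "winding_number ?\<gamma> w = -1"
    by auto
  show ?thesis
  proof (rule simple_closed_path_winding_number_inside[OF smooth_jordan_path(3)],
      unfold path_image_unit_path)
    assume "\<And>z. z \<in> inside (curve_trace e) \<Longrightarrow> winding_number ?\<gamma> z = 1"
    from this[OF w(1)] w(2) show ?thesis by simp
  next
    assume "\<And>z. z \<in> inside (curve_trace e) \<Longrightarrow> winding_number ?\<gamma> z = -1"
    from this[OF z] show ?thesis .
  qed
qed

end

section \<open>Domains bounded by smooth Jordan curves\<close>

lemma smooth_jordan_inside_outside:
  assumes "smooth_jordan_param e"
  shows "inside (curve_trace e) \<noteq> {}" "open (inside (curve_trace e))" "connected (inside (curve_trace e))"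
    "open (outside (curve_trace e))" "connected (outside (curve_trace e))"
    "frontier (inside (curve_trace e)) = curve_trace e"
    "frontier (outside (curve_trace e)) = curve_trace e"
    "compact (curve_trace e)"
  using Jordan_inside_outside[OF smooth_jordan_path(3,2)[OF assms]]
    compact_path_image[OF valid_path_imp_path[OF smooth_jordan_path(1)[OF assms]]]
  unfolding path_image_unit_path by blast+

text \<open>Janiszewski's theorem adds one curve at a time: if neither of two sets separates the
  points and their intersection is connected, their union does not separate them. Here the
  intersection is empty.\<close>

lemma connected_component_Compl_finite_UN:
  fixes \<Gamma> :: "'i \<Rightarrow> complex set"
  assumes "finite I" and \<Gamma>: "\<And>i. i \<in> I \<Longrightarrow> compact (\<Gamma> i) \<and> connected_component (- \<Gamma> i) z w"
    and "\<And>i j. i \<in> I \<Longrightarrow> j \<in> I \<Longrightarrow> i \<noteq> j \<Longrightarrow> \<Gamma> i \<inter> \<Gamma> j = {}"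
  shows "connected_component (- (\<Union>i\<in>I. \<Gamma> i)) z w"
  using assms
proof (induction I)
  case empty
  then show ?case by (simp add: connected_component_def) (use connected_UNIV in blast)
next
  case (insert i I)
  have "connected_component (- (\<Gamma> i \<union> (\<Union>i\<in>I. \<Gamma> i))) z w"
  proof (rule Janiszewski)
    show "closed (\<Union>i\<in>I. \<Gamma> i)"
      using insert by (intro closed_UN) (auto simp: compact_imp_closed)
    have "\<Gamma> i \<inter> (\<Union>i\<in>I. \<Gamma> i) = {}"
      using insert.prems(2)[of i] insert.hyps by fastforce
    then show "connected (\<Gamma> i \<inter> (\<Union>i\<in>I. \<Gamma> i))" by simp
  qed (use insert in auto)
  then show ?case by simp
qed

lemma subset_if_disjoint_frontier:
  assumes "connected T" "T \<inter> frontier S = {}" "w \<in> T" "w \<in> S"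
  shows "T \<subseteq> S"
  using connected_Int_frontier[OF assms(1), of S] assms by blast

context
  fixes K :: "complex set" and l :: nat and \<eta> :: "nat \<Rightarrow> real \<Rightarrow> complex"
  assumes K: "domain_at_infinity K" and bd: "boundary_param K l \<eta>"
begin

lemma domain_open: "open K" and domain_connected: "connected K" and domain_bounded: "bounded (- K)"
  using K by (auto simp: domain_at_infinity_def)

lemma boundary_smooth: "k \<in> {1..l} \<Longrightarrow> smooth_jordan_param (\<eta> k)"
  using bd by (simp add: boundary_param_def)

lemma boundary_left: "k \<in> {1..l} \<Longrightarrow> \<forall>\<^sub>F \<epsilon> in at_right 0. normal_shift (\<eta> k) \<epsilon> t \<in> K"
  using bd by (simp add: boundary_param_def lies_left_of_def normal_shift_def)

lemma boundary_disjoint: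
  "j \<in> {1..l} \<Longrightarrow> k \<in> {1..l} \<Longrightarrow> j \<noteq> k \<Longrightarrow> curve_trace (\<eta> j) \<inter> curve_trace (\<eta> k) = {}"
  using bd by (simp add: boundary_param_def)

lemma frontier_domain: "frontier K = (\<Union>k\<in>{1..l}. curve_trace (\<eta> k))"
  using bd by (simp add: boundary_param_def)

lemma domain_disjoint_boundary: "k \<in> {1..l} \<Longrightarrow> K \<inter> curve_trace (\<eta> k) = {}"
  using frontier_domain frontier_disjoint_eq[of K] domain_open by blast

lemma boundary_subset_closure: "k \<in> {1..l} \<Longrightarrow> curve_trace (\<eta> k) \<subseteq> closure K"
  using frontier_domain by (force simp: frontier_def)

text \<open>\<open>K\<close> is connected, unbounded and misses the curve, so it lies in the
  unbounded component of the complement.\<close>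

lemma domain_subset_outside:
  assumes k: "k \<in> {1..l}"
  shows "K \<subseteq> outside (curve_trace (\<eta> k))"
proof
  fix x assume x: "x \<in> K"
  have "K \<subseteq> - curve_trace (\<eta> k)" using domain_disjoint_boundary[OF k] by blast
  then have "K \<subseteq> connected_component_set (- curve_trace (\<eta> k)) x"
    using x domain_connected by (intro connected_component_maximal) auto
  moreover have "\<not> bounded K"
    using domain_bounded not_bounded_UNIV bounded_Un[of K "- K"] by auto
  ultimately have "\<not> bounded (connected_component_set (- curve_trace (\<eta> k)) x)"
    using bounded_subset by blast
  then show "x \<in> outside (curve_trace (\<eta> k))"
    using domain_disjoint_boundary[OF k] x by (auto simp: outside)
qed

text \<open>Taking closures in \<open>domain_subset_outside\<close> can add only the curve
  \<open>k\<close> itself, which is disjoint from the curve \<open>j\<close>.\<close>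

lemma boundary_subset_outside:
  assumes j: "j \<in> {1..l}" and k: "k \<in> {1..l}" and "j \<noteq> k"
  shows "curve_trace (\<eta> j) \<subseteq> outside (curve_trace (\<eta> k))"
proof -
  have "closure K \<subseteq> closure (outside (curve_trace (\<eta> k)))"
    using closure_mono[OF domain_subset_outside[OF k]] .
  also have "\<dots> = outside (curve_trace (\<eta> k)) \<union> curve_trace (\<eta> k)"
    using smooth_jordan_inside_outside(7)[OF boundary_smooth[OF k]] by (simp add: closure_Un_frontier)
  finally show ?thesis
    using boundary_subset_closure[OF j] boundary_disjoint[OF j k \<open>j \<noteq> k\<close>] by blast
qed

text \<open>Being connected and off the curve \<open>j\<close>, the inside of the curve
  \<open>k\<close> lies on one side of it. On the inner side it would drag its frontier, the curve
  \<open>k\<close>, along, but that curve lies outside the curve \<open>j\<close>.\<close>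

lemma inside_subset_outside:
  assumes j: "j \<in> {1..l}" and k: "k \<in> {1..l}" and ne: "j \<noteq> k"
  shows "inside (curve_trace (\<eta> k)) \<subseteq> outside (curve_trace (\<eta> j))"
proof -
  let ?\<Gamma> = "\<lambda>k. curve_trace (\<eta> k)"
  note J = smooth_jordan_inside_outside[OF boundary_smooth[OF j]]
  note JK = smooth_jordan_inside_outside[OF boundary_smooth[OF k]]
  have "inside (?\<Gamma> k) \<inter> ?\<Gamma> j = {}"
    using boundary_subset_outside[OF j k ne] inside_Int_outside[of "?\<Gamma> k"] by blast
  then have sub: "inside (?\<Gamma> k) \<subseteq> inside (?\<Gamma> j) \<union> outside (?\<Gamma> j)"
    using inside_Un_outside[of "?\<Gamma> j"] by blast
  have "inside (?\<Gamma> j) \<inter> inside (?\<Gamma> k) = {} \<or> outside (?\<Gamma> j) \<inter> inside (?\<Gamma> k) = {}"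
    using inside_Int_outside[of "?\<Gamma> j"] sub by (intro connectedD[OF JK(3) J(2) J(4)]) auto
  then show ?thesis
  proof
    assume "outside (?\<Gamma> j) \<inter> inside (?\<Gamma> k) = {}"
    then have "closure (inside (?\<Gamma> k)) \<subseteq> closure (inside (?\<Gamma> j))"
      using sub by (intro closure_mono) blast
    then have "?\<Gamma> k \<subseteq> inside (?\<Gamma> j) \<union> ?\<Gamma> j"
      using J(6) JK(6) by (auto simp: closure_Un_frontier)
    moreover have "?\<Gamma> k \<subseteq> outside (?\<Gamma> j)" using boundary_subset_outside[OF k j] ne by simp
    ultimately have "?\<Gamma> k = {}"
      using inside_Int_outside[of "?\<Gamma> j"] outside_no_overlap[of "?\<Gamma> j"] by blast
    then show ?thesis by (simp add: curve_trace_def)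
  qed (use sub in blast)
qed

text \<open>A point off all closed insides is outside every curve, as is every point of
  \<open>K\<close>. No single curve separates the two, hence neither does the whole frontier, and
  the connecting set cannot leave \<open>K\<close>.\<close>

lemma Compl_domain_cases:
  assumes "z \<notin> K"
  shows "\<exists>k\<in>{1..l}. z \<in> closure (inside (curve_trace (\<eta> k)))"
proof (rule ccontr)
  let ?\<Gamma> = "\<lambda>k. curve_trace (\<eta> k)"
  assume "\<not> (\<exists>k\<in>{1..l}. z \<in> closure (inside (?\<Gamma> k)))"
  then have not: "z \<notin> closure (inside (?\<Gamma> k))" if "k \<in> {1..l}" for k using that by blast
  have out: "z \<in> outside (?\<Gamma> k)" if k: "k \<in> {1..l}" for k
  proof -
    have "z \<notin> inside (?\<Gamma> k)" "z \<notin> ?\<Gamma> k"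
      using not[OF k] smooth_jordan_inside_outside(6)[OF boundary_smooth[OF k]]
      by (auto simp: closure_Un_frontier)
    then show ?thesis by (metis ComplI UnE inside_Un_outside)
  qed
  obtain w where w: "w \<in> K"
    using domain_bounded not_bounded_UNIV by (metis Compl_empty_eq ex_in_conv)
  have "connected_component (- (\<Union>k\<in>{1..l}. ?\<Gamma> k)) z w"
  proof (rule connected_component_Compl_finite_UN)
    fix k assume k: "k \<in> {1..l}"
    note J = smooth_jordan_inside_outside[OF boundary_smooth[OF k]]
    have "connected_component (- ?\<Gamma> k) z w"
      unfolding connected_component_def
      using J(5) out[OF k] domain_subset_outside[OF k] w outside_no_overlap[of "?\<Gamma> k"]
      by (intro exI[of _ "outside (?\<Gamma> k)"] conjI) blast+
    then show "compact (?\<Gamma> k) \<and> connected_component (- ?\<Gamma> k) z w" using J(8) by simp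
  qed (use boundary_disjoint in auto)
  then obtain T where T: "connected T" "T \<subseteq> - frontier K" "z \<in> T" "w \<in> T"
    unfolding connected_component_def frontier_domain[symmetric] by blast
  then have "T \<subseteq> K" using w by (intro subset_if_disjoint_frontier[of T K w]) auto
  then show False using T assms by blast
qed

text \<open>This makes the pointwise left condition uniform in \<open>t\<close>: the strip
  \<open>T\<close> of shifted points is connected and misses the frontier, so a single point of it
  in \<open>K\<close>, taken at parameter 0, puts all of it in \<open>K\<close>.\<close>

lemma normal_shift_in_domain_single:
  assumes k: "k \<in> {1..l}"
  shows "\<exists>\<epsilon>>0. \<forall>s t. 0 < s \<and> s < \<epsilon> \<longrightarrow> normal_shift (\<eta> k) s t \<in> K"
proof -
  let ?\<Gamma> = "\<lambda>k. curve_trace (\<eta> k)" and ?e' = "\<lambda>t. vector_derivative (\<eta> k) (at t)"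
  note e = boundary_smooth[OF k]
  obtain \<epsilon>1 where "\<epsilon>1 > 0" and
    \<epsilon>1: "\<forall>s t. 0 < \<bar>s\<bar> \<and> \<bar>s\<bar> < \<epsilon>1 \<longrightarrow> normal_shift (\<eta> k) s t \<notin> ?\<Gamma> k"
    using normal_shift_off_curve[OF e] by (elim exE conjE)
  define Q where "Q = (\<Union>j\<in>{1..l} - {k}. ?\<Gamma> j)"
  have "closed Q" unfolding Q_def
    by (intro closed_UN) (auto intro!: compact_imp_closed smooth_jordan_inside_outside(8) boundary_smooth)
  moreover have "?\<Gamma> k \<inter> Q = {}" using boundary_disjoint[OF k] unfolding Q_def by blast
  ultimately have "\<exists>d>0. \<forall>x\<in>?\<Gamma> k. \<forall>y\<in>Q. d \<le> dist x y"
    by (intro separate_compact_closed smooth_jordan_inside_outside(8)[OF e])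
  then obtain d where "d > 0" and d: "\<forall>x\<in>?\<Gamma> k. \<forall>y\<in>Q. d \<le> dist x y"
    by (elim exE conjE)
  have "compact (?e' ` {0..2 * pi})"
    by (intro compact_continuous_image smooth_jordan_deriv_continuous[OF e]) auto
  from compact_imp_bounded[OF this]
  obtain M where "M > 0" and M': "\<forall>w\<in>?e' ` {0..2 * pi}. cmod w \<le> M"
    unfolding bounded_pos by (elim exE conjE)
  have M: "cmod (?e' t) \<le> M" for t
  proof -
    obtain n where n: "t - 2 * pi * of_int n \<in> {0..<2 * pi}" by (rule reduce_mod_period)
    then have "cmod (?e' (t - 2 * pi * of_int n)) \<le> M"
      using bspec[OF M' imageI, of "t - 2 * pi * of_int n"] by simp
    then show ?thesis using smooth_jordan_deriv_shift_period[OF e, of t "- n"] by simp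
  qed
  \<comment> \<open>Below \<open>\<epsilon>1\<close> the shift stays off its own curve; below
    \<open>d / M\<close> it moves by less than the distance \<open>d\<close> to the other
    curves.\<close>
  define \<epsilon> where "\<epsilon> = min \<epsilon>1 (d / M)"
  have "\<epsilon> > 0" using \<open>\<epsilon>1 > 0\<close> \<open>d > 0\<close> \<open>M > 0\<close> by (simp add: \<epsilon>_def)
  define T where "T = (\<lambda>x. normal_shift (\<eta> k) (fst x) (snd x)) ` ({0<..<\<epsilon>} \<times> UNIV)"
  have "continuous_on ({0<..<\<epsilon>} \<times> UNIV) (\<lambda>x. normal_shift (\<eta> k) (fst x) (snd x))"
    unfolding normal_shift_def
    by (intro continuous_intros continuous_on_compose2[OF smooth_jordan_continuous[OF e, of UNIV]]
        continuous_on_compose2[OF smooth_jordan_deriv_continuous[OF e, of UNIV]]) auto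
  then have T: "connected T"
    unfolding T_def by (intro connected_continuous_image connected_Times) auto
  have "normal_shift (\<eta> k) s t \<notin> frontier K" if s: "0 < s" "s < \<epsilon>" for s t
  proof
    assume "normal_shift (\<eta> k) s t \<in> frontier K"
    moreover have "normal_shift (\<eta> k) s t \<notin> ?\<Gamma> k" using \<epsilon>1 s by (auto simp: \<epsilon>_def)
    ultimately have "normal_shift (\<eta> k) s t \<in> Q" unfolding frontier_domain Q_def by blast
    then have "d \<le> dist (\<eta> k t) (normal_shift (\<eta> k) s t)"
      using d curve_trace_eq_range[OF e] by blast
    also have "\<dots> = s * cmod (?e' t)" using s by (simp add: normal_shift_def dist_norm norm_mult)
    also have "\<dots> \<le> s * M" using M[of t] s by (intro mult_left_mono) auto
    also have "\<dots> < d" using s \<open>M > 0\<close> by (simp add: \<epsilon>_def field_simps)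
    finally show False by simp
  qed
  then have disj: "T \<inter> frontier K = {}" by (auto simp: T_def)
  have "\<forall>\<^sub>F s in at_right 0. s \<in> {0<..<\<epsilon>} \<and> normal_shift (\<eta> k) s 0 \<in> K"
    using eventually_at_right_real[OF \<open>\<epsilon> > 0\<close>] boundary_left[OF k, of 0] by (rule eventually_conj)
  then obtain s0 where s0: "s0 \<in> {0<..<\<epsilon>}" "normal_shift (\<eta> k) s0 0 \<in> K"
    using eventually_happens'[OF trivial_limit_at_right_real] by blast
  have "normal_shift (\<eta> k) s0 0 \<in> T" using s0(1) by (force simp: T_def)
  from subset_if_disjoint_frontier[OF T disj this s0(2)] have sub: "T \<subseteq> K" .
  have "normal_shift (\<eta> k) s t \<in> K" if "0 < s \<and> s < \<epsilon>" for s t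
  proof -
    have "normal_shift (\<eta> k) s t \<in> T" unfolding T_def using that by (intro image_eqI[of _ _ "(s, t)"]) auto
    then show ?thesis using sub by blast
  qed
  with \<open>\<epsilon> > 0\<close> show ?thesis by blast
qed

lemma normal_shift_in_domain:
  "\<exists>\<epsilon>>0. \<forall>k\<in>{1..l}. \<forall>s t. 0 < s \<and> s < \<epsilon> \<longrightarrow> normal_shift (\<eta> k) s t \<in> K"
proof -
  have "\<forall>k\<in>{1..l}. \<exists>\<epsilon>>0. \<forall>s t. 0 < s \<and> s < \<epsilon> \<longrightarrow> normal_shift (\<eta> k) s t \<in> K"
    using normal_shift_in_domain_single by blast
  from bchoice[OF this] obtain \<epsilon> where
    \<epsilon>: "\<forall>k\<in>{1..l}. \<epsilon> k > 0 \<and> (\<forall>s t. 0 < s \<and> s < \<epsilon> k \<longrightarrow> normal_shift (\<eta> k) s t \<in> K)" ..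
  show ?thesis
  proof (intro exI[of _ "Min (insert 1 (\<epsilon> ` {1..l}))"] conjI ballI allI impI)
    show "Min (insert 1 (\<epsilon> ` {1..l})) > 0" using \<epsilon> by (subst Min_gr_iff) auto
    fix k s t assume k: "k \<in> {1..l}" and s: "0 < s \<and> s < Min (insert 1 (\<epsilon> ` {1..l}))"
    have "Min (insert 1 (\<epsilon> ` {1..l})) \<le> \<epsilon> k" using k by (intro Min_le) auto
    then show "normal_shift (\<eta> k) s t \<in> K" using \<epsilon> k s by force
  qed
qed

lemma winding_number_boundary_inside:
  assumes j: "j \<in> {1..l}" and k: "k \<in> {1..l}" and z: "z \<in> inside (curve_trace (\<eta> k))"
  shows "winding_number (unit_path (\<eta> j)) z = (if j = k then -1 else 0)"
proof (cases "j = k")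
  case True
  have "\<forall>\<^sub>F \<epsilon> in at_right 0. normal_shift (\<eta> k) \<epsilon> pi \<in> outside (curve_trace (\<eta> k))"
    using boundary_left[OF k, of pi] by eventually_elim (use domain_subset_outside[OF k] in blast)
  then show ?thesis using winding_number_inside_of_left_outside[OF boundary_smooth[OF k] _ z] True by simp
next
  case False
  then show ?thesis
    using inside_subset_outside[OF j k] z smooth_jordan_path[OF boundary_smooth[OF j]]
    by (auto intro!: winding_number_zero_in_outside simp: path_image_unit_path valid_path_imp_path)
qed

text \<open>The shifted curves lie in \<open>K\<close>, so their winding numbers are constant on
  each closed inside, boundary included. They may be computed at an inner point \<open>y\<close>,
  where the straight homotopy back to the original curves never passes.\<close>

lemma winding_number_normal_shift_Compl:
  assumes s: "0 < s" and sK: "\<And>k s' t. k \<in> {1..l} \<Longrightarrow> 0 < s' \<Longrightarrow> s' \<le> s \<Longrightarrow> normal_shift (\<eta> k) s' t \<in> K"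
    and z: "z \<notin> K"
  shows "(\<Sum>j=1..l. winding_number (unit_path (normal_shift (\<eta> j) s)) z) = -1"
proof -
  let ?\<Gamma> = "\<lambda>k. curve_trace (\<eta> k)"
  obtain k where k: "k \<in> {1..l}" and zk: "z \<in> closure (inside (?\<Gamma> k))"
    using Compl_domain_cases[OF z] by blast
  note J = smooth_jordan_inside_outside[OF boundary_smooth[OF k]]
  obtain y where y: "y \<in> inside (?\<Gamma> k)" using J(1) by blast
  have inK: "inside (?\<Gamma> k) \<inter> K = {}"
    using domain_subset_outside[OF k] inside_Int_outside[of "?\<Gamma> k"] by blast
  then have clK: "closure (inside (?\<Gamma> k)) \<inter> K = {}"
    using domain_disjoint_boundary[OF k] J(6) by (auto simp: closure_Un_frontier)
  have "winding_number (unit_path (normal_shift (\<eta> j) s)) z = (if j = k then -1 else 0)"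
    if j: "j \<in> {1..l}" for j
  proof -
    note e = boundary_smooth[OF j]
    let ?p = "unit_path (normal_shift (\<eta> j) s)"
    have p: "path ?p" "pathfinish ?p = pathstart ?p" and q: "path (unit_path (\<eta> j))"
        "pathfinish (unit_path (\<eta> j)) = pathstart (unit_path (\<eta> j))"
      using normal_shift_path[OF e] smooth_jordan_path[OF e] valid_path_imp_path by auto
    have "path_image ?p \<subseteq> K"
      unfolding path_image_unit_path curve_trace_def using sK[OF j s] by auto
    then have "winding_number ?p constant_on closure (inside (?\<Gamma> k))"
      using clK J(3) by (intro winding_number_constant[OF p] connected_imp_connected_closure) auto
    then obtain c where c: "\<forall>x\<in>closure (inside (?\<Gamma> k)). winding_number ?p x = c"
      unfolding constant_on_def by (elim exE)
    have "winding_number ?p z = winding_number ?p y"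
      using bspec[OF c zk] bspec[OF c subsetD[OF closure_subset y]] by simp
    also have "\<dots> = winding_number (unit_path (\<eta> j)) y"
    proof (rule winding_number_loops_linear_eq[OF q(1) p(1) q(2) p(2)])
      fix t :: real
      show "y \<notin> closed_segment (unit_path (\<eta> j) t) (?p t)"
      proof
        assume "y \<in> closed_segment (unit_path (\<eta> j) t) (?p t)"
        then obtain u where u: "0 \<le> u" "u \<le> 1"
            "y = (1 - u) *\<^sub>R unit_path (\<eta> j) t + u *\<^sub>R ?p t"
          by (auto simp: closed_segment_def)
        \<comment> \<open>A point of the homotopy is a normal shift by \<open>u * s\<close>, which
          is why \<open>sK\<close> is required for all lengths up to \<open>s\<close>.\<close>
        then have yu: "y = normal_shift (\<eta> j) (u * s) (2 * pi * t)"
          by (simp add: unit_path_def normal_shift_def scaleR_conv_of_real algebra_simps)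
        show False
        proof (cases "u = 0")
          case True
          then have "y \<in> ?\<Gamma> j" using yu curve_trace_eq_range[OF e] by (simp add: normal_shift_def)
          moreover have "y \<notin> ?\<Gamma> j"
            using y inside_no_overlap[of "?\<Gamma> k"] inside_subset_outside[OF j k] outside_no_overlap[of "?\<Gamma> j"]
            by (cases "j = k") blast+
          ultimately show False by blast
        next
          case False
          then have "normal_shift (\<eta> j) (u * s) (2 * pi * t) \<in> K"
            using u s by (intro sK[OF j]) (auto simp: mult_left_le_one_le)
          then show False using yu y inK by blast
        qed
      qed
    qed
    finally show ?thesis using winding_number_boundary_inside[OF j k y] by simp
  qed
  then have "(\<Sum>j=1..l. winding_number (unit_path (normal_shift (\<eta> j) s)) z) = (\<Sum>j=1..l. if j = k then -1 else 0)"
    by (intro sum.cong) auto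
  then show ?thesis using k by (simp add: sum.delta)
qed

lemma Cauchy_theorem_normal_shift:
  assumes s: "0 < s" and sK: "\<And>k s' t. k \<in> {1..l} \<Longrightarrow> 0 < s' \<Longrightarrow> s' \<le> s \<Longrightarrow> normal_shift (\<eta> k) s' t \<in> K"
    and R: "- K \<subseteq> ball 0 R" "R > 0" and g: "g holomorphic_on K"
  shows "(\<Sum>j=1..l. contour_integral (unit_path (normal_shift (\<eta> j) s)) g)
           + contour_integral (circlepath 0 R) g = 0"
proof -
  \<comment> \<open>The curves are numbered from 1, so index 0 is free for the circle; its winding
    number 1 cancels the total -1 of the shifted curves.\<close>
  define \<gamma> where "\<gamma> = (\<lambda>j. if j = 0 then circlepath 0 R else unit_path (normal_shift (\<eta> j) s))"
  have split: "(\<Sum>j\<in>{0..l}. F (\<gamma> j)) = F (circlepath 0 R) + (\<Sum>j=1..l. F (unit_path (normal_shift (\<eta> j) s)))"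
    for F :: "(real \<Rightarrow> complex) \<Rightarrow> complex"
    by (simp add: sum.atLeast_Suc_atMost \<gamma>_def)
  have "(\<Sum>j\<in>{0..l}. contour_integral (\<gamma> j) g) = 0"
  proof (rule Cauchy_theorem_cycle[OF domain_open domain_connected g])
    fix j assume j: "j \<in> {0..l}"
    show "valid_path (\<gamma> j) \<and> pathfinish (\<gamma> j) = pathstart (\<gamma> j) \<and> path_image (\<gamma> j) \<subseteq> K"
    proof (cases "j = 0")
      case True
      then show ?thesis using R by (force simp: \<gamma>_def)
    next
      case False
      then have j': "j \<in> {1..l}" using j by auto
      have "path_image (unit_path (normal_shift (\<eta> j) s)) \<subseteq> K"
        unfolding path_image_unit_path curve_trace_def using sK[OF j' s] by auto
      then show ?thesis using normal_shift_path[OF boundary_smooth[OF j']] False by (simp add: \<gamma>_def)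
    qed
  next
    fix z assume z: "z \<notin> K"
    then have "winding_number (circlepath 0 R) z = 1"
      using R by (intro winding_number_circlepath) auto
    then show "(\<Sum>j\<in>{0..l}. winding_number (\<gamma> j) z) = 0"
      using winding_number_normal_shift_Compl[OF s sK z] split[of "\<lambda>p. winding_number p z"] by simp
  qed auto
  then show ?thesis using split[of "\<lambda>p. contour_integral p g"] by (simp add: add.commute)
qed

text \<open>As \<open>g\<close> need not extend holomorphically across the boundary, the curves are pushed into
  the domain along their normals, and the shift is then sent to \<open>0\<close>.\<close>

lemma boundary_integral_eq_circle:
  assumes R: "- K \<subseteq> ball 0 R" "R > 0" and g: "g holomorphic_on K" "continuous_on (closure K) g"
  shows "(\<Sum>j=1..l. integral {0..2 * pi} (\<lambda>t. g (\<eta> j t) * vector_derivative (\<eta> j) (at t)))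
           + contour_integral (circlepath 0 R) g = 0"
proof -
  let ?e' = "\<lambda>j t. vector_derivative (\<eta> j) (at t)"
  let ?e'' = "\<lambda>j t. vector_derivative (\<lambda>t. vector_derivative (\<eta> j) (at t)) (at t)"
  obtain \<epsilon> where "\<epsilon> > 0" and
    \<epsilon>: "\<forall>k\<in>{1..l}. \<forall>s t. 0 < s \<and> s < \<epsilon> \<longrightarrow> normal_shift (\<eta> k) s t \<in> K"
    using normal_shift_in_domain by (elim exE conjE)
  \<comment> \<open>Half of \<open>\<epsilon>\<close> keeps the closed interval in the admissible
    range. At 0 the shift lies only in the closure of \<open>K\<close>, where continuity of
    \<open>g\<close> suffices; \<open>F j 0\<close> is the integrand on the original curve.\<close>
  define U where "U = {0..\<epsilon> / 2}"
  define F where "F = (\<lambda>j s t. g (normal_shift (\<eta> j) s t) * (?e' j t + of_real s * (\<i> * ?e'' j t)))"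
  have cont: "continuous_on U (\<lambda>s. integral (cbox 0 (2 * pi)) (F j s))" if j: "j \<in> {1..l}" for j
  proof (rule integral_continuous_on_param)
    note e = boundary_smooth[OF j]
    have cl: "normal_shift (\<eta> j) s t \<in> closure K" if "s \<in> U" for s t
    proof (cases "s = 0")
      case True
      then have "normal_shift (\<eta> j) s t \<in> curve_trace (\<eta> j)"
        using curve_trace_eq_range[OF e] by (simp add: normal_shift_def)
      then show ?thesis using boundary_subset_closure[OF j] by blast
    next
      case False
      then have "normal_shift (\<eta> j) s t \<in> K" using \<epsilon> j that by (auto simp: U_def)
      then show ?thesis using closure_subset by blast
    qed
    have e1: "continuous_on V (\<lambda>x. \<eta> j (snd x))" "continuous_on V (\<lambda>x. ?e' j (snd x))"
        "continuous_on V (\<lambda>x. ?e'' j (snd x))" for V :: "(real \<times> real) set"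
      by (intro continuous_on_compose2[OF smooth_jordan_continuous[OF e, of UNIV]]
          continuous_on_compose2[OF smooth_jordan_deriv_continuous[OF e, of UNIV]]
          continuous_on_compose2[OF smooth_jordan_second_deriv_continuous[OF e, of UNIV]] continuous_intros; simp)+
    have "continuous_on (U \<times> cbox 0 (2 * pi)) (\<lambda>x. normal_shift (\<eta> j) (fst x) (snd x))"
      unfolding normal_shift_def by (intro continuous_intros e1)
    then have "continuous_on (U \<times> cbox 0 (2 * pi)) (\<lambda>x. g (normal_shift (\<eta> j) (fst x) (snd x)))"
      by (rule continuous_on_compose2[OF g(2)]) (auto intro: cl)
    then have "continuous_on (U \<times> cbox 0 (2 * pi)) (\<lambda>x. F j (fst x) (snd x))"
      unfolding F_def by (intro continuous_intros e1)
    then show "continuous_on (U \<times> cbox 0 (2 * pi)) (\<lambda>(s, t). F j s t)"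
      by (simp add: case_prod_beta')
  qed
  define G where "G = (\<lambda>s. (\<Sum>j=1..l. integral (cbox 0 (2 * pi)) (F j s)) + contour_integral (circlepath 0 R) g)"
  have "continuous_on U G" unfolding G_def by (intro continuous_intros cont)
  moreover have "0 \<in> U" using \<open>\<epsilon> > 0\<close> by (simp add: U_def)
  ultimately have "(G \<longlongrightarrow> G 0) (at 0 within U)" by (simp add: continuous_on_def)
  then have "(G \<longlongrightarrow> G 0) (at_right 0)"
    using at_within_Icc_at_right[of 0 "\<epsilon> / 2"] \<open>\<epsilon> > 0\<close> by (simp add: U_def)
  moreover have "\<forall>\<^sub>F s in at_right 0. G s = 0"
    using eventually_at_right_real[OF \<open>\<epsilon> > 0\<close>]
  proof eventually_elim
    case (elim s)
    have "integral (cbox 0 (2 * pi)) (F j s) = contour_integral (unit_path (normal_shift (\<eta> j) s)) g"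
      if j: "j \<in> {1..l}" for j
    proof -
      note D = normal_shift_derivative[OF boundary_smooth[OF j], of s]
      have "normal_shift (\<eta> j) s differentiable at t" for t
        using D[of t] by (rule differentiableI_vector)
      from contour_integral_unit_path[of "normal_shift (\<eta> j) s", OF this]
      show ?thesis by (simp add: F_def vector_derivative_at[OF D])
    qed
    then have "G s = (\<Sum>j=1..l. contour_integral (unit_path (normal_shift (\<eta> j) s)) g) + contour_integral (circlepath 0 R) g"
      unfolding G_def by (intro arg_cong2[where f = "(+)"] sum.cong) auto
    also have "\<dots> = 0"
      using elim \<epsilon> by (intro Cauchy_theorem_normal_shift R g) auto
    finally show ?case .
  qed
  ultimately have "((\<lambda>s::real. 0) \<longlongrightarrow> G 0) (at_right 0)"
    by (rule Lim_transform_eventually)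
  then have "G 0 = 0"
    using tendsto_unique[OF trivial_limit_at_right_real] tendsto_const by blast
  then show ?thesis by (simp add: G_def F_def normal_shift_def)
qed

end

section \<open>Behaviour at infinity\<close>

text \<open>Compared with \<open>c / z\<close>, the integrand has error o(1/R) on a circle of length
  2 pi R, so the integrals differ by o(1). Being independent of \<open>R\<close>, they
  agree.\<close>

lemma circle_integral_of_residue_at_infinity:
  assumes lim: "((\<lambda>z. z * g z) \<longlongrightarrow> c) at_infinity"
    and int: "\<And>R. R > R0 \<Longrightarrow> g contour_integrable_on circlepath 0 R"
    and const: "\<And>R. R > R0 \<Longrightarrow> contour_integral (circlepath 0 R) g = C"
  shows "C = 2 * of_real pi * \<i> * c"
proof -
  have "cmod (C - 2 * of_real pi * \<i> * c) \<le> 0 + e" if "e > 0" for e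
  proof -
    have "\<forall>\<^sub>F z in at_infinity. dist (z * g z) c < e / (2 * pi)"
      using that by (intro tendstoD[OF lim]) simp
    then obtain B where B: "\<And>z. norm z \<ge> B \<Longrightarrow> dist (z * g z) c < e / (2 * pi)"
      unfolding eventually_at_infinity by blast
    define R where "R = Max {B, R0 + 1, 1}"
    have R: "R \<ge> B" "R > R0" "R > 0" by (auto simp: R_def)
    have "((\<lambda>z. c / (z - 0)) has_contour_integral 2 * of_real pi * \<i> * c) (circlepath 0 R)"
      using R by (intro Cauchy_integral_circlepath_simple[where f = "\<lambda>_. c"]) auto
    moreover have "(g has_contour_integral C) (circlepath 0 R)"
      using int[OF R(2)] const[OF R(2)] has_contour_integral_integral by blast
    ultimately have "((\<lambda>z. g z - c / (z - 0)) has_contour_integral C - 2 * of_real pi * \<i> * c) (circlepath 0 R)"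
      by (intro has_contour_integral_diff)
    then have "cmod (C - 2 * of_real pi * \<i> * c) \<le> (e / (2 * pi) / R) * (2 * pi * R)"
    proof (rule has_contour_integral_bound_circlepath)
      fix x assume "cmod (x - 0) = R"
      then have x: "cmod x = R" by simp
      then have "x \<noteq> 0" using R by auto
      then have "g x - c / (x - 0) = (x * g x - c) / x" by (simp add: field_simps)
      moreover have "cmod (x * g x - c) \<le> e / (2 * pi)" using B[of x] x R by (simp add: dist_norm)
      then have "cmod (x * g x - c) / R \<le> e / (2 * pi) / R" using R by (intro divide_right_mono) auto
      ultimately show "cmod (g x - c / (x - 0)) \<le> e / (2 * pi) / R"
        using x by (simp only: norm_divide)
    qed (use R that in auto)
    then show ?thesis using R by simp
  qed
  then have "cmod (C - 2 * of_real pi * \<i> * c) \<le> 0" by (rule field_le_epsilon)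
  then show ?thesis by simp
qed

text \<open>The function \<open>\<phi>\<close>, the entire extension of (exp w - 1)/w, gives
  \<open>g z * \<phi> (g z) = exp (g z) - 1\<close>, which is explicit. As
  \<open>\<phi> (g z)\<close> tends to 1, division by it recovers \<open>g z\<close>, even where
  \<open>g z\<close> is 0 and without a choice of logarithm.\<close>

lemma log_quotient_at_infinity:
  fixes f g :: "complex \<Rightarrow> complex"
  assumes f: "((\<lambda>z. f z - z) \<longlongrightarrow> 0) at_infinity" and g: "(g \<longlongrightarrow> 0) at_infinity"
    and eq: "\<forall>\<^sub>F z in at_infinity. exp (g z) = (f z - a) / (z - \<alpha>)"
  shows "((\<lambda>z. z * g z) \<longlongrightarrow> \<alpha> - a) at_infinity"
proof -
  define \<phi> where "\<phi> = (\<lambda>w::complex. if w = 0 then 1 else (exp w - 1) / w)"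
  have "((\<lambda>w::complex. (exp w - 1) / w) \<longlongrightarrow> 1) (at 0)"
    using DERIV_exp[of "0::complex"] by (simp add: DERIV_def)
  then have "(\<phi> \<longlongrightarrow> 1) (at 0)"
    by (rule Lim_transform_eventually) (auto simp: \<phi>_def eventually_at_filter)
  then have "isCont \<phi> 0" by (simp add: isCont_def \<phi>_def)
  then have lim\<phi>: "((\<lambda>z. \<phi> (g z)) \<longlongrightarrow> 1) at_infinity"
    using isCont_tendsto_compose[OF _ g, of \<phi>] by (simp add: \<phi>_def)
  have "((\<lambda>z. \<alpha> / z) \<longlongrightarrow> 0) at_infinity"
    by (intro tendsto_divide_0[OF tendsto_const] filterlim_ident)
  from tendsto_diff[OF tendsto_const[of 1] this]
  have "((\<lambda>z. 1 - \<alpha> / z) \<longlongrightarrow> 1) at_infinity" by simp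
  then have "((\<lambda>z. (f z - z + (\<alpha> - a)) / (1 - \<alpha> / z) / \<phi> (g z)) \<longlongrightarrow> (0 + (\<alpha> - a)) / 1 / 1) at_infinity"
    by (intro tendsto_intros f lim\<phi>) auto
  then have "((\<lambda>z. (f z - z + (\<alpha> - a)) / (1 - \<alpha> / z) / \<phi> (g z)) \<longlongrightarrow> \<alpha> - a) at_infinity"
    by simp
  moreover have "\<forall>\<^sub>F z in at_infinity. (f z - z + (\<alpha> - a)) / (1 - \<alpha> / z) / \<phi> (g z) = z * g z"
  proof -
    have "\<forall>\<^sub>F z in at_infinity. \<phi> (g z) \<noteq> 0"
      using tendsto_imp_eventually_ne[OF lim\<phi>, of 0] by simp
    moreover have "\<forall>\<^sub>F z in at_infinity. cmod z \<ge> cmod \<alpha> + 1"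
      by (auto simp: eventually_at_infinity)
    ultimately show ?thesis using eq
    proof eventually_elim
      case (elim z)
      have "cmod z > 0" "cmod z \<noteq> cmod \<alpha>" using elim(2) norm_ge_zero[of \<alpha>] by linarith+
      then have z: "z \<noteq> 0" "z \<noteq> \<alpha>" by auto
      have "g z * \<phi> (g z) = exp (g z) - 1" by (simp add: \<phi>_def)
      also have "\<dots> = (f z - z + (\<alpha> - a)) / (z - \<alpha>)"
        using z elim by (simp add: field_simps)
      finally have "g z = (f z - z + (\<alpha> - a)) / (z - \<alpha>) / \<phi> (g z)"
        using elim(1) by (metis nonzero_mult_div_cancel_right)
      then have "z * g z = z * ((f z - z + (\<alpha> - a)) / (z - \<alpha>)) / \<phi> (g z)"
        by (metis times_divide_eq_right)
      also have "z * ((f z - z + (\<alpha> - a)) / (z - \<alpha>)) = (f z - z + (\<alpha> - a)) / (1 - \<alpha> / z)"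
        using z by (simp add: field_simps)
      finally show ?case by (rule sym)
    qed
  qed
  ultimately show ?thesis by (rule Lim_transform_eventually)
qed

theorem lemma4p4:
  fixes K :: "complex set" and l :: nat and \<eta> :: "nat \<Rightarrow> real \<Rightarrow> complex"
    and a \<alpha> :: "nat \<Rightarrow> complex" and m :: "nat \<Rightarrow> real" and \<tau> :: real
    and \<Phi> :: "complex \<Rightarrow> complex" and Lg :: "nat \<Rightarrow> complex \<Rightarrow> complex"
  assumes "l \<ge> 1"
    and "domain_at_infinity K"
    and "boundary_param K l \<eta>"
    and "walsh_map K l \<eta> a m \<tau> \<Phi>"
    and "\<forall>j\<in>{1..l}. \<alpha> j \<in> inside (curve_trace (\<eta> j))"
    and "\<forall>j\<in>{1..l}. log_branch K (\<lambda>z. (\<Phi> z - a j) / (z - \<alpha> j)) (Lg j)"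
  shows "\<forall>j\<in>{1..l}.
    1 / (2 * of_real pi * \<i>) *
      (\<Sum>k=1..l. integral {0..2 * pi}
         (\<lambda>t. Lg j (\<eta> k t) * vector_derivative (\<eta> k) (at t)))
    + \<alpha> j - a j = 0"
proof
  fix j assume j: "j \<in> {1..l}"
  let ?I = "\<Sum>k=1..l. integral {0..2 * pi} (\<lambda>t. Lg j (\<eta> k t) * vector_derivative (\<eta> k) (at t))"
  have g: "Lg j holomorphic_on K" "\<And>z. z \<in> K \<Longrightarrow> exp (Lg j z) = (\<Phi> z - a j) / (z - \<alpha> j)"
      "(Lg j \<longlongrightarrow> 0) at_infinity" "continuous_on (closure K) (Lg j)"
    using assms(6) j by (auto simp: log_branch_def)
  have "bounded (- K)" using assms(2) by (simp add: domain_at_infinity_def)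
  then obtain B where "B > 0" and B: "- K \<subseteq> ball 0 B"
    using bounded_subset_ballD by blast
  have inK: "z \<in> K" if "cmod z \<ge> B" for z using B that by fastforce
  have "\<forall>\<^sub>F z in at_infinity. z \<in> K"
    unfolding eventually_at_infinity using inK by blast
  then have ev: "\<forall>\<^sub>F z in at_infinity. exp (Lg j z) = (\<Phi> z - a j) / (z - \<alpha> j)"
    by eventually_elim (rule g(2))
  have "(\<lambda>z. \<Phi> z - z) \<in> O[at_infinity](\<lambda>z. 1 / z)"
    using assms(4) by (simp add: walsh_map_def)
  moreover have "((\<lambda>z::complex. 1 / z) \<longlongrightarrow> 0) at_infinity"
    by (intro tendsto_divide_0[OF tendsto_const] filterlim_ident)
  then have "(\<lambda>z::complex. 1 / z) \<in> o[at_infinity](\<lambda>_. 1 :: complex)"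
    by (intro smalloI_tendsto) auto
  ultimately have "(\<lambda>z. \<Phi> z - z) \<in> o[at_infinity](\<lambda>_. 1)"
    by (rule landau_o.big_small_trans)
  then have "((\<lambda>z. \<Phi> z - z) \<longlongrightarrow> 0) at_infinity"
    using smalloD_tendsto by fastforce
  from log_quotient_at_infinity[OF this g(3) ev]
  have lim: "((\<lambda>z. z * Lg j z) \<longlongrightarrow> \<alpha> j - a j) at_infinity" .
  \<comment> \<open>The boundary integral does not involve the radius, so the circle integral takes
    the same value \<open>- ?I\<close> for every \<open>R > B\<close>.\<close>
  have "- ?I = 2 * of_real pi * \<i> * (\<alpha> j - a j)"
  proof (rule circle_integral_of_residue_at_infinity[OF lim])
    fix R assume R: "B < R"
    have "- K \<subseteq> ball 0 R" using B R by auto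
    from boundary_integral_eq_circle[OF assms(2,3) this _ g(1,4)] R \<open>B > 0\<close>
    show "contour_integral (circlepath 0 R) (Lg j) = - ?I" by (simp add: eq_neg_iff_add_eq_0 add.commute)
    show "Lg j contour_integrable_on circlepath 0 R"
      using g(1) assms(2) inK R \<open>B > 0\<close>
      by (intro contour_integrable_holomorphic_simple[of _ K]) (auto simp: domain_at_infinity_def)
  qed
  then have "?I = - (2 * of_real pi * \<i>) * (\<alpha> j - a j)" by (simp add: neg_eq_iff_add_eq_0 eq_neg_iff_add_eq_0)
  then show "1 / (2 * of_real pi * \<i>) * ?I + \<alpha> j - a j = 0" by simp
qed

end
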